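(* Let $\mathcal F=(F,<,+,\cdot,0,1,\ldots)$ be a d-minimal expansion of an ordered field. Let $E$ be a definable subset of $F^n$ and let $f,g:E\to F\cup\{\pm\infty\}$ be definable maps such that the interval $[f(x),g(x)]=\{y\in F \mid f(x)\le y\le g(x)\}$ is nonempty for each $x\in E$. Assume further that $f$ is upper semi-continuous and $g$ is lower semi-continuous. Then there exists a definable continuous function $h:E\to F$ such that $f\le h\le g$ on $E$. Moreover, $h$ can be chosen so that $f(x)<h(x)<g(x)$ whenever $x \in E$ and $f(x)<g(x)$.
   Context: Throughout, "definable" means definable in the given structure with parameters. The universe $F$ carries the order topology induced by $<$, $F^n$ carries the product topology, and subsets carry the subspace topology. A map $f:E\to F\cup\{\pm\infty\}$ is definable if $f^{-1}(\infty)$ and $f^{-1}(-\infty)$ are definable and the restriction of $f$ to $f^{-1}(F)$ is definable. An expansion $\mathcal F=(F,<,\ldots)$ of a dense linear order without endpoints is definably complete if every definable subset of $F$ has both a supremum and an infimum in $F\cup\{\pm\infty\}$. It is d-minimal if it is definably complete and every definable subset $X$ of $F$ is the union of an open set and finitely many discrete sets, where the number of discrete sets does not depend on the parameters of definition of $X$ (i.e., for each formula there is a bound on the number of discrete sets valid for all choices of parameters). A function $f:X\to F\cup\{\pm\infty\}$ is lower (resp. upper) semi-continuous if the set $\{x\in X\mid f(x)>a\}$ (resp. $\{x\in X\mid f(x)<a\}$) is open in $X$ for each $a\in F\cup\{\pm\infty\}$. *)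

theory Defs
  imports "HOL-Analysis.Analysis" "HOL-Library.Extended" "HOL-Library.Lub_Glb"
begin

section \<open>First-order structures expanding an ordered field\<close>

text \<open>
  The language consists of the symbols of ordered rings together with arbitrary further function
  symbols \<open>'f\<close> and relation symbols \<open>'r\<close>. Extra symbols take an argument list, so an
  element of \<open>'f\<close> or \<open>'r\<close> stands for one symbol of each arity. A language with fixed
  arities is recovered by interpreting the unused arities trivially, which adds no definable sets.
  The universe of a structure is the whole type \<open>'a\<close>, and the ordered field symbols are
  interpreted by the type class operations.
\<close>

datatype ('f, 'r) trm =
    Var nat
  | Zero
  | One
  | Add "('f, 'r) trm" "('f, 'r) trm"
  | Mult "('f, 'r) trm" "('f, 'r) trm"
  | Fun 'f "('f, 'r) trm list"

datatype ('f, 'r) fm =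
    Eq "('f, 'r) trm" "('f, 'r) trm"
  | Less "('f, 'r) trm" "('f, 'r) trm"
  | Rel 'r "('f, 'r) trm list"
  | Neg "('f, 'r) fm"
  | Conj "('f, 'r) fm" "('f, 'r) fm"
  | Exists nat "('f, 'r) fm"

record ('a, 'f, 'r) expansion =
  fun_interp :: "'f \<Rightarrow> 'a list \<Rightarrow> 'a"
  rel_interp :: "'r \<Rightarrow> 'a list \<Rightarrow> bool"

primrec eval_trm ::
  "('a::linordered_field, 'f, 'r) expansion \<Rightarrow> (nat \<Rightarrow> 'a) \<Rightarrow> ('f, 'r) trm \<Rightarrow> 'a" where
  "eval_trm S v (Var i) = v i"
| "eval_trm S v Zero = 0"
| "eval_trm S v One = 1"
| "eval_trm S v (Add s t) = eval_trm S v s + eval_trm S v t"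
| "eval_trm S v (Mult s t) = eval_trm S v s * eval_trm S v t"
| "eval_trm S v (Fun k ts) = fun_interp S k (map (eval_trm S v) ts)"

primrec sat ::
  "('a::linordered_field, 'f, 'r) expansion \<Rightarrow> (nat \<Rightarrow> 'a) \<Rightarrow> ('f, 'r) fm \<Rightarrow> bool" where
  "sat S v (Eq s t) \<longleftrightarrow> eval_trm S v s = eval_trm S v t"
| "sat S v (Less s t) \<longleftrightarrow> eval_trm S v s < eval_trm S v t"
| "sat S v (Rel k ts) \<longleftrightarrow> rel_interp S k (map (eval_trm S v) ts)"
| "sat S v (Neg \<phi>) \<longleftrightarrow> \<not> sat S v \<phi>"
| "sat S v (Conj \<phi> \<psi>) \<longleftrightarrow> sat S v \<phi> \<and> sat S v \<psi>"
| "sat S v (Exists i \<phi>) \<longleftrightarrow> (\<exists>a. sat S (v(i := a)) \<phi>)"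


section \<open>Definability with parameters\<close>

text \<open>
  Points of $F^n$ are functions on \<open>{..<n}\<close>, extended by \<open>undefined\<close>.
\<close>

definition power_space :: "nat \<Rightarrow> (nat \<Rightarrow> 'a) set" where
  "power_space n = {..<n} \<rightarrow>\<^sub>E UNIV"

text \<open>
  The variables below \<open>n\<close> range over the point, all other free variables are parameters
  with values given by \<open>p\<close>. Only the finitely many values of \<open>p\<close> at variables
  occurring in the formula matter.
\<close>

definition definable ::
  "('a::linordered_field, 'f, 'r) expansion \<Rightarrow> nat \<Rightarrow> (nat \<Rightarrow> 'a) set \<Rightarrow> bool" where
  "definable S n X \<longleftrightarrow>
     (\<exists>(\<phi> :: ('f, 'r) fm) p. X = {x \<in> power_space n. sat S (\<lambda>i. if i < n then x i else p i) \<phi>})"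

definition fm_set ::
  "('a::linordered_field, 'f, 'r) expansion \<Rightarrow> ('f, 'r) fm \<Rightarrow> (nat \<Rightarrow> 'a) \<Rightarrow> 'a set" where
  "fm_set S \<phi> p = {a. sat S (p(0 := a)) \<phi>}"

definition definable1 ::
  "('a::linordered_field, 'f, 'r) expansion \<Rightarrow> 'a set \<Rightarrow> bool" where
  "definable1 S X \<longleftrightarrow> (\<exists>\<phi> p. X = fm_set S \<phi> p)"

lemma definable1_iff_definable:
  "definable1 S X \<longleftrightarrow> definable S 1 {x \<in> power_space 1. x 0 \<in> X}"
proof -
  have upd: "(\<lambda>i. if i < 1 then x i else p i) = p(0 := x 0)" for x p :: "nat \<Rightarrow> 'a"
    by auto
  have "X = fm_set S \<phi> p \<longleftrightarrow>
      {x \<in> power_space 1. x 0 \<in> X} = {x \<in> power_space 1. sat S (p(0 := x 0)) \<phi>}" for \<phi> p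
  proof
    assume eq: "{x \<in> power_space 1. x 0 \<in> X} = {x \<in> power_space 1. sat S (p(0 := x 0)) \<phi>}"
    have "a \<in> X \<longleftrightarrow> sat S (p(0 := a)) \<phi>" for a
    proof -
      let ?x = "restrict (\<lambda>_. a) {..<1::nat}"
      have "?x \<in> power_space 1" "?x 0 = a"
        by (auto simp: power_space_def)
      then show ?thesis
        using eq by (metis (mono_tags, lifting) mem_Collect_eq)
    qed
    then show "X = fm_set S \<phi> p"
      by (auto simp: fm_set_def)
  qed (auto simp: fm_set_def)
  then show ?thesis
    unfolding definable1_def definable_def upd by simp
qed

text \<open>A map from $E \subseteq F^n$ to $F$ is definable if its graph in $F^{n+1}$ is.\<close>

definition definable_map ::
  "('a::linordered_field, 'f, 'r) expansion \<Rightarrow> nat \<Rightarrow> (nat \<Rightarrow> 'a) set \<Rightarrow> ((nat \<Rightarrow> 'a) \<Rightarrow> 'a) \<Rightarrow> bool" where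
  "definable_map S n E h \<longleftrightarrow>
     definable S (Suc n)
       {z \<in> power_space (Suc n). restrict z {..<n} \<in> E \<and> h (restrict z {..<n}) = z n}"

definition definable_ext_map ::
  "('a::linordered_field, 'f, 'r) expansion \<Rightarrow> nat \<Rightarrow> (nat \<Rightarrow> 'a) set \<Rightarrow>
     ((nat \<Rightarrow> 'a) \<Rightarrow> 'a extended) \<Rightarrow> bool" where
  "definable_ext_map S n E f \<longleftrightarrow>
     definable S n {x \<in> E. f x = Pinf} \<and>
     definable S n {x \<in> E. f x = Minf} \<and>
     definable_map S n {x \<in> E. f x \<in> range Fin} (\<lambda>x. inv Fin (f x))"


section \<open>d-minimality\<close>

definition definably_complete :: "('a::linordered_field, 'f, 'r) expansion \<Rightarrow> bool" where
  "definably_complete S \<longleftrightarrow>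
     (\<forall>X. definable1 S X \<longrightarrow>
        (\<exists>s :: 'a extended. isLub UNIV (Fin ` X) s) \<and> (\<exists>s :: 'a extended. isGlb UNIV (Fin ` X) s))"

text \<open>
  The class \<open>linorder_topology\<close> makes \<open>open\<close> the order topology of the field. The bound
  \<open>N\<close> depends on the formula only; \<open>D i\<close> may be empty, so at most \<open>N\<close> discrete sets are used.
\<close>

definition d_minimal ::
  "('a::{linordered_field, linorder_topology}, 'f, 'r) expansion \<Rightarrow> bool" where
  "d_minimal S \<longleftrightarrow> definably_complete S \<and>
     (\<forall>\<phi>. \<exists>N::nat. \<forall>p. \<exists>U D.
        open U \<and> (\<forall>i<N. discrete (D i)) \<and> fm_set S \<phi> p = U \<union> (\<Union>i<N. D i))"


section \<open>Topology on subsets of powers, semi-continuity\<close>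

definition subspace_top :: "nat \<Rightarrow> (nat \<Rightarrow> 'a::topological_space) set \<Rightarrow> (nat \<Rightarrow> 'a) topology" where
  "subspace_top n E = subtopology (product_topology (\<lambda>_. euclidean) {..<n}) E"

definition lower_semicontinuous :: "'b topology \<Rightarrow> ('b \<Rightarrow> 'a::linorder extended) \<Rightarrow> bool" where
  "lower_semicontinuous T f \<longleftrightarrow> (\<forall>a. openin T {x \<in> topspace T. f x > a})"

definition upper_semicontinuous :: "'b topology \<Rightarrow> ('b \<Rightarrow> 'a::linorder extended) \<Rightarrow> bool" where
  "upper_semicontinuous T f \<longleftrightarrow> (\<forall>a. openin T {x \<in> topspace T. f x < a})"

end

theory Submission
  imports Defs
begin

text \<open>
  The classical insertion theorem builds the inserted function as a limit of countably many steps,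
  and such a limit need not be definable. Here the inserted function has an explicit definition.

  Let $A$ be the closed region on or below the graph of $f$ in $E \times F$ and $B$ the closed
  region on or above the graph of $g$. Write $a_x(y)$ and $b_x(-y)$ for the sup-norm distances, cut
  off at 1, from $(x,y)$ to $A$ and to $B$. Since $A$ is closed downward and $B$ upward, the first
  is nondecreasing in $y$ and the second nonincreasing. Semicontinuity says that $a_x(y) > 0$ iff
  $f(x) < y$, and that $b_x(-y) > 0$ iff $y < g(x)$. The point $h(x)$ is where the two distances
  balance. Distances may be locally constant in $y$, so that plain equality could leave a whole
  interval of candidates; the equation used is therefore
  $w(y) a_x(y) = w(-y) b_x(-y)$ with $w(y) = 1 + \max(y, 0)$. The quotient $w(y)/w(-y)$ is
  strictly increasing from 0 to infinity, which makes the balance point unique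
  (\<open>not_below_imp_above\<close>), and finite even where $f$ or $g$ is infinite. Wherever
  $f(x) < g(x)$ the left side is negligible near $f(x)$ and the right side near $g(x)$, so that the
  balance point lies strictly between (\<open>balance_point\<close>).

  Distances are 1-Lipschitz in $x$, hence a strict inequality between the two sides at a fixed
  height persists nearby (\<open>below_nearby\<close>). Every $y < h(x)$ and every $y > h(x)$
  satisfies such an inequality, and this is continuity of $h$.

  Definable completeness supplies the suprema that define the two distances and $h$. Definability
  of $h$ holds because all conditions involved are first-order; to see this without writing
  formulas, the file works with predicates on valuations that some formula defines.
\<close>

section \<open>A calculus of definable predicates\<close>

text \<open>
  The variables below \<open>k\<close> are the free ones; all others are parameters, fixed once for
  all \<open>v\<close>. Keeping \<open>Q\<close> as a predicate on all valuations lets a quantifier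
  be a function update and a substitution of variables be a composition.
\<close>

definition definable_pred ::
  "('a::linordered_field, 'f, 'r) expansion \<Rightarrow> nat \<Rightarrow> ((nat \<Rightarrow> 'a) \<Rightarrow> bool) \<Rightarrow> bool" where
  "definable_pred S k Q \<longleftrightarrow>
     (\<exists>(\<phi> :: ('f, 'r) fm) p. \<forall>v. Q v \<longleftrightarrow> sat S (\<lambda>i. if i < k then v i else p i) \<phi>)"

primrec rename_trm :: "(nat \<Rightarrow> nat) \<Rightarrow> ('f, 'r) trm \<Rightarrow> ('f, 'r) trm" where
  "rename_trm \<rho> (Var i) = Var (\<rho> i)"
| "rename_trm \<rho> Zero = Zero"
| "rename_trm \<rho> One = One"
| "rename_trm \<rho> (Add s t) = Add (rename_trm \<rho> s) (rename_trm \<rho> t)"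
| "rename_trm \<rho> (Mult s t) = Mult (rename_trm \<rho> s) (rename_trm \<rho> t)"
| "rename_trm \<rho> (Fun k ts) = Fun k (map (rename_trm \<rho>) ts)"

primrec rename_fm :: "(nat \<Rightarrow> nat) \<Rightarrow> ('f, 'r) fm \<Rightarrow> ('f, 'r) fm" where
  "rename_fm \<rho> (Eq s t) = Eq (rename_trm \<rho> s) (rename_trm \<rho> t)"
| "rename_fm \<rho> (Less s t) = Less (rename_trm \<rho> s) (rename_trm \<rho> t)"
| "rename_fm \<rho> (Rel k ts) = Rel k (map (rename_trm \<rho>) ts)"
| "rename_fm \<rho> (Neg \<phi>) = Neg (rename_fm \<rho> \<phi>)"
| "rename_fm \<rho> (Conj \<phi> \<psi>) = Conj (rename_fm \<rho> \<phi>) (rename_fm \<rho> \<psi>)"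
| "rename_fm \<rho> (Exists i \<phi>) = Exists (\<rho> i) (rename_fm \<rho> \<phi>)"

lemma eval_rename_trm: "eval_trm S v (rename_trm \<rho> t) = eval_trm S (v \<circ> \<rho>) t"
proof (induction t)
  case (Fun k ts)
  then have "map (eval_trm S v \<circ> rename_trm \<rho>) ts = map (eval_trm S (v \<circ> \<rho>)) ts"
    by (intro map_cong) (simp_all add: comp_def)
  then show ?case by (simp only: rename_trm.simps eval_trm.simps map_map)
qed (simp_all add: comp_def)

text \<open>
  Bound variables are renamed along with free ones, so no capture can occur as long as the renaming
  is injective.
\<close>

lemma sat_rename_fm:
  assumes "inj \<rho>"
  shows "sat S v (rename_fm \<rho> \<phi>) \<longleftrightarrow> sat S (v \<circ> \<rho>) \<phi>"
proof (induction \<phi> arbitrary: v)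
  case (Rel k ts)
  have "map (eval_trm S v \<circ> rename_trm \<rho>) ts = map (eval_trm S (v \<circ> \<rho>)) ts"
    by (simp add: eval_rename_trm)
  then show ?case by (simp only: rename_fm.simps sat.simps map_map)
next
  case (Exists i \<phi>)
  have "v(\<rho> i := a) \<circ> \<rho> = (v \<circ> \<rho>)(i := a)" for a
    using assms by (auto simp: inj_eq)
  then show ?case using Exists by (simp only: rename_fm.simps sat.simps)
qed (simp_all add: eval_rename_trm)

lemma definable_pred_cong_val:
  assumes "definable_pred S k Q" "\<And>i. i < k \<Longrightarrow> v i = w i"
  shows "Q v \<longleftrightarrow> Q w"
proof -
  from assms(1) obtain \<phi> p where "\<And>v. Q v \<longleftrightarrow> sat S (\<lambda>i. if i < k then v i else p i) \<phi>"
    unfolding definable_pred_def by blast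
  moreover have "(\<lambda>i. if i < k then v i else p i) = (\<lambda>i. if i < k then w i else p i)"
    using assms(2) by auto
  ultimately show ?thesis by simp
qed

lemma definable_pred_Not:
  assumes "definable_pred S k Q"
  shows "definable_pred S k (\<lambda>v. \<not> Q v)"
proof -
  from assms obtain \<phi> p where "\<forall>v. Q v \<longleftrightarrow> sat S (\<lambda>i. if i < k then v i else p i) \<phi>"
    unfolding definable_pred_def by blast
  then show ?thesis
    unfolding definable_pred_def by (intro exI[of _ "Neg \<phi>"] exI[of _ p]) simp
qed

text \<open>
  The two formulas may use the same variables for different parameters. Their parameters are moved
  to the even and to the odd variables beyond \<open>k\<close>.
\<close>

lemma definable_pred_conj:
  assumes "definable_pred S k Q" "definable_pred S k R"
  shows "definable_pred S k (\<lambda>v. Q v \<and> R v)"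
proof -
  from assms(1) obtain \<phi> p where Q: "\<And>v. Q v \<longleftrightarrow> sat S (\<lambda>i. if i < k then v i else p i) \<phi>"
    unfolding definable_pred_def by blast
  from assms(2) obtain \<psi> q where R: "\<And>v. R v \<longleftrightarrow> sat S (\<lambda>i. if i < k then v i else q i) \<psi>"
    unfolding definable_pred_def by blast
  define \<rho> where "\<rho> = (\<lambda>i. if i < k then i else 2 * i)"
  define \<sigma> where "\<sigma> = (\<lambda>i. if i < k then i else 2 * i + 1)"
  define u where "u = (\<lambda>j. if even j then p (j div 2) else q (j div 2))"
  have inj: "inj \<rho>" "inj \<sigma>"
    by (auto simp: inj_def \<rho>_def \<sigma>_def split: if_splits)
  have "(\<lambda>i. if i < k then v i else u i) \<circ> \<rho> = (\<lambda>i. if i < k then v i else p i)"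
       "(\<lambda>i. if i < k then v i else u i) \<circ> \<sigma> = (\<lambda>i. if i < k then v i else q i)" for v
    by (auto simp: \<rho>_def \<sigma>_def u_def fun_eq_iff)
  then have "Q v \<and> R v \<longleftrightarrow>
      sat S (\<lambda>i. if i < k then v i else u i) (Conj (rename_fm \<rho> \<phi>) (rename_fm \<sigma> \<psi>))" for v
    by (simp add: Q R sat_rename_fm inj)
  then show ?thesis unfolding definable_pred_def by blast
qed

lemma definable_pred_disj:
  assumes "definable_pred S k Q" "definable_pred S k R"
  shows "definable_pred S k (\<lambda>v. Q v \<or> R v)"
  using definable_pred_Not[OF definable_pred_conj[OF assms[THEN definable_pred_Not]]] by simp

lemma definable_pred_imp:
  assumes "definable_pred S k Q" "definable_pred S k R"
  shows "definable_pred S k (\<lambda>v. Q v \<longrightarrow> R v)"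
  using definable_pred_disj[OF definable_pred_Not[OF assms(1)] assms(2)] by simp

lemma definable_pred_ex:
  assumes "definable_pred S (Suc k) Q"
  shows "definable_pred S k (\<lambda>v. \<exists>a. Q (v(k := a)))"
proof -
  from assms obtain \<phi> p where Q: "\<And>v. Q v \<longleftrightarrow> sat S (\<lambda>i. if i < Suc k then v i else p i) \<phi>"
    unfolding definable_pred_def by blast
  have "(\<lambda>i. if i < Suc k then (v(k := a)) i else p i) = (\<lambda>i. if i < k then v i else p i)(k := a)"
    for v a by auto
  then have "(\<exists>a. Q (v(k := a))) \<longleftrightarrow> sat S (\<lambda>i. if i < k then v i else p i) (Exists k \<phi>)" for v
    by (simp only: Q sat.simps)
  then show ?thesis unfolding definable_pred_def by blast
qed

lemma definable_pred_all:
  assumes "definable_pred S (Suc k) Q"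
  shows "definable_pred S k (\<lambda>v. \<forall>a. Q (v(k := a)))"
  using definable_pred_Not[OF definable_pred_ex[OF definable_pred_Not[OF assms]]] by simp

text \<open>
  Quantifies the variables from \<open>k\<close> up to \<open>k + m\<close>: a quantifier over points of
  a power of the universe.
\<close>

lemma definable_pred_all_block:
  assumes "definable_pred S (k + m) Q"
  shows "definable_pred S k (\<lambda>v. \<forall>w. Q (\<lambda>i. if i < k then v i else w i))"
  using assms
proof (induction m arbitrary: Q)
  case 0
  then have "Q (\<lambda>i. if i < k then v i else w i) \<longleftrightarrow> Q v" for v w
    by (intro definable_pred_cong_val[of S k]) auto
  then show ?case using 0 by simp
next
  case (Suc m)
  let ?m = "\<lambda>v w i. if i < k then v i else w i"
  have "definable_pred S (k + m) (\<lambda>v. \<forall>a. Q (v(k + m := a)))"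
    using Suc.prems by (intro definable_pred_all) simp
  from Suc.IH[OF this]
  have "definable_pred S k (\<lambda>v. \<forall>w a. Q ((?m v w)(k + m := a)))" .
  moreover have "(\<forall>w a. Q ((?m v w)(k + m := a))) \<longleftrightarrow> (\<forall>w. Q (?m v w))" for v
  proof (intro iffI allI)
    fix w assume "\<forall>w a. Q ((?m v w)(k + m := a))"
    then have "Q ((?m v w)(k + m := w (k + m)))" by blast
    moreover have "(?m v w)(k + m := w (k + m)) = ?m v w" by auto
    ultimately show "Q (?m v w)" by simp
  next
    fix w a assume "\<forall>w. Q (?m v w)"
    then have "Q (?m v (w(k + m := a)))" by blast
    moreover have "?m v (w(k + m := a)) = (?m v w)(k + m := a)" by auto
    ultimately show "Q ((?m v w)(k + m := a))" by simp
  qed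
  ultimately show ?case by simp
qed

lemma definable_pred_ex_block:
  assumes "definable_pred S (k + m) Q"
  shows "definable_pred S k (\<lambda>v. \<exists>w. Q (\<lambda>i. if i < k then v i else w i))"
  using definable_pred_Not[OF definable_pred_all_block[OF definable_pred_Not[OF assms]]] by simp

text \<open>
  Substitutes distinct variables for the free ones; the parameters are shifted out of the way of the
  new free variables.
\<close>

lemma definable_pred_rename:
  assumes "definable_pred S k Q" "inj_on \<rho> {..<k}" "\<And>i. i < k \<Longrightarrow> \<rho> i < m"
  shows "definable_pred S m (\<lambda>v. Q (\<lambda>i. v (\<rho> i)))"
proof -
  from assms obtain \<phi> p where Q: "\<And>v. Q v \<longleftrightarrow> sat S (\<lambda>i. if i < k then v i else p i) \<phi>"
    unfolding definable_pred_def by blast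
  define \<sigma> where "\<sigma> = (\<lambda>i. if i < k then \<rho> i else m + i)"
  have "inj \<sigma>"
    using assms(2,3) by (force simp: inj_def inj_on_def \<sigma>_def)
  moreover have "(\<lambda>i. if i < m then v i else p (i - m)) \<circ> \<sigma> = (\<lambda>i. if i < k then v (\<rho> i) else p i)" for v
    using assms(3) by (auto simp: \<sigma>_def fun_eq_iff)
  ultimately have "Q (\<lambda>i. v (\<rho> i)) \<longleftrightarrow>
      sat S (\<lambda>i. if i < m then v i else p (i - m)) (rename_fm \<sigma> \<phi>)" for v
    by (simp add: Q sat_rename_fm)
  then show ?thesis
    unfolding definable_pred_def
    by (intro exI[of _ "rename_fm \<sigma> \<phi>"] exI[of _ "\<lambda>i. p (i - m)"]) simp
qed

lemma definable_pred_weaken: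
  assumes "definable_pred S k Q" "k \<le> m"
  shows "definable_pred S m Q"
  using definable_pred_rename[OF assms(1), of "\<lambda>i. i" m] assms(2) by simp

text \<open>
  Demanding the equation for every \<open>p\<close> excludes parameters from the term, so that two
  terms can be combined without renaming.
\<close>

definition term_fun ::
  "('a::linordered_field, 'f, 'r) expansion \<Rightarrow> nat \<Rightarrow> ((nat \<Rightarrow> 'a) \<Rightarrow> 'a) \<Rightarrow> bool" where
  "term_fun S k \<tau> \<longleftrightarrow>
     (\<exists>t :: ('f, 'r) trm. \<forall>v p. \<tau> v = eval_trm S (\<lambda>i. if i < k then v i else p i) t)"

lemma term_fun_intros:
  "i < k \<Longrightarrow> term_fun S k (\<lambda>v. v i)"
  "term_fun S k (\<lambda>v. 0)"
  "term_fun S k (\<lambda>v. 1)"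
  "term_fun S k \<tau> \<Longrightarrow> term_fun S k \<upsilon> \<Longrightarrow> term_fun S k (\<lambda>v. \<tau> v + \<upsilon> v)"
  "term_fun S k \<tau> \<Longrightarrow> term_fun S k \<upsilon> \<Longrightarrow> term_fun S k (\<lambda>v. \<tau> v * \<upsilon> v)"
  unfolding term_fun_def
  subgoal by (rule exI[of _ "Var i"]) simp
  subgoal by (rule exI[of _ Zero]) simp
  subgoal by (rule exI[of _ One]) simp
  subgoal
    apply (elim exE)
    subgoal for s t by (rule exI[of _ "Add s t"]) simp
    done
  subgoal
    apply (elim exE)
    subgoal for s t by (rule exI[of _ "Mult s t"]) simp
    done
  done

lemma definable_pred_less:
  assumes "term_fun S k \<tau>" "term_fun S k \<upsilon>"
  shows "definable_pred S k (\<lambda>v. \<tau> v < \<upsilon> v)"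
proof -
  from assms obtain s t where
    "\<And>v p. \<tau> v = eval_trm S (\<lambda>i. if i < k then v i else p i) s"
    "\<And>v p. \<upsilon> v = eval_trm S (\<lambda>i. if i < k then v i else p i) t"
    unfolding term_fun_def by blast
  then show ?thesis
    unfolding definable_pred_def by (intro exI[of _ "Less s t"] exI[of _ "\<lambda>_. 0"]) simp
qed

lemma definable_pred_eq:
  assumes "term_fun S k \<tau>" "term_fun S k \<upsilon>"
  shows "definable_pred S k (\<lambda>v. \<tau> v = \<upsilon> v)"
proof -
  from assms obtain s t where
    "\<And>v p. \<tau> v = eval_trm S (\<lambda>i. if i < k then v i else p i) s"
    "\<And>v p. \<upsilon> v = eval_trm S (\<lambda>i. if i < k then v i else p i) t"
    unfolding term_fun_def by blast
  then show ?thesis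
    unfolding definable_pred_def by (intro exI[of _ "Eq s t"] exI[of _ "\<lambda>_. 0"]) simp
qed

lemma definable_pred_le:
  assumes "term_fun S k \<tau>" "term_fun S k \<upsilon>"
  shows "definable_pred S k (\<lambda>v. \<tau> v \<le> \<upsilon> v)"
  using definable_pred_Not[OF definable_pred_less[OF assms(2,1)]] by (simp add: not_less)

lemma definable_pred_const: "definable_pred S k (\<lambda>v. B)"
proof (cases B)
  case True
  have "definable_pred S k (\<lambda>v. (0::'a) = 0)"
    by (intro definable_pred_eq term_fun_intros)
  then show ?thesis using True by simp
next
  case False
  have "definable_pred S k (\<lambda>v. (0::'a) < 0)"
    by (intro definable_pred_less term_fun_intros)
  then show ?thesis using False by simp
qed

lemma definable_pred_all_bounded:
  fixes m :: nat
  assumes "\<And>i. i < m \<Longrightarrow> definable_pred S k (Q i)"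
  shows "definable_pred S k (\<lambda>v. \<forall>i<m. Q i v)"
  using assms
proof (induction m)
  case 0
  then show ?case by (simp add: definable_pred_const)
next
  case (Suc m)
  have "definable_pred S k (\<lambda>v. (\<forall>i<m. Q i v) \<and> Q m v)"
    using Suc by (intro definable_pred_conj) auto
  moreover have "(\<forall>i<Suc m. Q i v) \<longleftrightarrow> (\<forall>i<m. Q i v) \<and> Q m v" for v
    by (auto simp: less_Suc_eq)
  ultimately show ?case by simp
qed

lemmas definable_pred_intros =
  definable_pred_Not definable_pred_conj definable_pred_disj definable_pred_imp
  definable_pred_less definable_pred_le definable_pred_eq definable_pred_all_bounded term_fun_intros

lemma definable_imp_definable_pred:
  assumes "definable S n X"
  shows "definable_pred S n (\<lambda>v. restrict v {..<n} \<in> X)"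
proof -
  from assms obtain \<phi> p
    where X: "X = {x \<in> power_space n. sat S (\<lambda>i. if i < n then x i else p i) \<phi>}"
    unfolding definable_def by blast
  have "restrict v {..<n} \<in> X \<longleftrightarrow> sat S (\<lambda>i. if i < n then v i else p i) \<phi>" for v
  proof -
    have "(\<lambda>i. if i < n then restrict v {..<n} i else p i) = (\<lambda>i. if i < n then v i else p i)"
      by auto
    moreover have "restrict v {..<n} \<in> power_space n"
      by (auto simp: power_space_def)
    ultimately show ?thesis by (simp add: X)
  qed
  then show ?thesis unfolding definable_pred_def by blast
qed

lemma definable_pred_imp_definable:
  assumes "definable_pred S n Q"
  shows "definable S n {x \<in> power_space n. Q x}"
proof -
  from assms obtain \<phi> p where "\<And>v. Q v \<longleftrightarrow> sat S (\<lambda>i. if i < n then v i else p i) \<phi>"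
    unfolding definable_pred_def by blast
  then show ?thesis
    unfolding definable_def by (intro exI[of _ \<phi>] exI[of _ p]) simp
qed

text \<open>
  All free variables other than \<open>j\<close> become parameters. Swapping the variables 0 and
  \<open>j\<close> brings the distinguished one to the place that \<open>fm_set\<close> expects.
\<close>

lemma definable_pred_imp_definable1:
  assumes "definable_pred S k Q" "j < k"
  shows "definable1 S {a. Q (v(j := a))}"
proof -
  from assms obtain \<phi> p where Q: "\<And>v. Q v \<longleftrightarrow> sat S (\<lambda>i. if i < k then v i else p i) \<phi>"
    unfolding definable_pred_def by blast
  define \<tau> where "\<tau> = id(0 := j, j := 0)"
  define m where "m = (\<lambda>i. if i < k then v i else p i)"
  have "inj \<tau>" by (auto simp: \<tau>_def inj_def)
  have "Q (v(j := a)) \<longleftrightarrow> sat S ((m \<circ> \<tau>)(0 := a)) (rename_fm \<tau> \<phi>)" for a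
  proof -
    have "(\<lambda>i. if i < k then (v(j := a)) i else p i) = ((m \<circ> \<tau>)(0 := a)) \<circ> \<tau>"
      using assms(2) by (auto simp: m_def \<tau>_def fun_eq_iff)
    then show ?thesis by (simp add: Q sat_rename_fm \<open>inj \<tau>\<close>)
  qed
  then show ?thesis unfolding definable1_def fm_set_def by blast
qed

lemma definable_map_iff_definable_pred:
  "definable_map S n E h \<longleftrightarrow>
   definable_pred S (Suc n) (\<lambda>v. restrict v {..<n} \<in> E \<and> h (restrict v {..<n}) = v n)"
proof
  have restr: "restrict (restrict v {..<Suc n}) {..<n} = restrict v {..<n}" for v :: "nat \<Rightarrow> 'a"
    by auto
  have pow: "restrict v {..<Suc n} \<in> power_space (Suc n)" for v :: "nat \<Rightarrow> 'a"
    by (auto simp: power_space_def)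
  assume "definable_map S n E h"
  from definable_imp_definable_pred[OF this[unfolded definable_map_def]]
  show "definable_pred S (Suc n) (\<lambda>v. restrict v {..<n} \<in> E \<and> h (restrict v {..<n}) = v n)"
    by (simp only: mem_Collect_eq restr pow simp_thms) simp
next
  assume "definable_pred S (Suc n) (\<lambda>v. restrict v {..<n} \<in> E \<and> h (restrict v {..<n}) = v n)"
  then show "definable_map S n E h"
    unfolding definable_map_def by (rule definable_pred_imp_definable)
qed

lemma definably_complete_isLub:
  fixes S :: "('a::linordered_field, 'f, 'r) expansion"
  assumes "definably_complete S" "definable1 S X" "x \<in> X" "\<And>y. y \<in> X \<Longrightarrow> y \<le> b"
  shows "\<exists>s. isLub UNIV X s"
proof -
  from assms obtain e where e: "isLub UNIV (Fin ` X) e"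
    unfolding definably_complete_def by blast
  have "e \<le> Fin b"
    using assms(4) by (intro isLub_le_isUb[OF e] isUbI setleI) auto
  moreover have "Fin x \<le> e"
    using assms(3) by (intro isLubD2[OF e]) auto
  ultimately obtain s where s: "e = Fin s" by (cases e) auto
  have "y \<le> s" if "y \<in> X" for y
    using isLubD2[OF e, of "Fin y"] that by (simp add: s)
  moreover have "s \<le> c" if "\<And>y. y \<in> X \<Longrightarrow> y \<le> c" for c
    using isLub_le_isUb[OF e, of "Fin c"] that by (auto simp: s isUb_def setle_def)
  ultimately have "isLub UNIV X s"
    by (auto simp: isLub_def leastP_def isUb_def setle_def setge_def)
  then show ?thesis ..
qed

section \<open>Balancing two distances on a line\<close>

text \<open>
  The positive function whose quotient \<open>weight y / weight (- y)\<close> increases strictly from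
  0 to infinity; it is piecewise linear, hence definable in any ordered field.
\<close>

definition weight :: "'a::linordered_field \<Rightarrow> 'a" where
  "weight y = 1 + max y 0"

lemma weight_ge_1: "1 \<le> weight y"
  by (simp add: weight_def)

lemma weight_pos: "0 < weight y"
  using weight_ge_1[of y] by linarith

lemma weight_mono: "y \<le> z \<Longrightarrow> weight y \<le> weight z"
  by (auto simp: weight_def max_def)

text \<open>
  The height \<open>y\<close> is below the balance point. The function \<open>b\<close> measures in the
  reflected line, so that exchanging \<open>a\<close> and \<open>b\<close> and negating \<open>y\<close>
  turns the picture upside down: \<open>below b a (- y)\<close> says that \<open>y\<close> is above the
  balance point.
\<close>

definition below :: "('a::linordered_field \<Rightarrow> 'a) \<Rightarrow> ('a \<Rightarrow> 'a) \<Rightarrow> 'a \<Rightarrow> bool" where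
  "below a b y \<longleftrightarrow> weight y * a y < weight (- y) * b (- y)"

text \<open>
  The truncated distances from the points of one vertical line to the two regions. The last
  assumption expresses that the lower region does not reach past the upper one on this line.
\<close>

locale distance_pair =
  fixes a b :: "'a::linordered_field \<Rightarrow> 'a"
  assumes mono: "y \<le> z \<Longrightarrow> a y \<le> a z" "y \<le> z \<Longrightarrow> b y \<le> b z"
    and nonneg: "0 \<le> a y" "0 \<le> b y"
    and le_1: "a y \<le> 1" "b y \<le> 1"
    and shift: "0 \<le> \<delta> \<Longrightarrow> a (y + \<delta>) \<le> a y + \<delta>" "0 \<le> \<delta> \<Longrightarrow> b (y + \<delta>) \<le> b y + \<delta>"
    and apart: "y < z \<Longrightarrow> 0 < a z \<or> 0 < b (- y)"
begin

lemma swapped: "distance_pair b a"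
  using mono nonneg le_1 shift apart
  by unfold_locales (metis minus_minus neg_less_iff_less)+

lemma below_downward:
  assumes "below a b y" "z \<le> y"
  shows "below a b z"
proof -
  have "weight z * a z \<le> weight y * a y"
    using assms(2) by (intro mult_mono weight_mono mono nonneg less_imp_le[OF weight_pos])
  also have "\<dots> < weight (- y) * b (- y)"
    using assms(1) by (simp add: below_def)
  also have "\<dots> \<le> weight (- z) * b (- z)"
    using assms(2) by (intro mult_mono weight_mono mono nonneg less_imp_le[OF weight_pos]) auto
  finally show ?thesis by (simp add: below_def)
qed

lemma below_imp_pos:
  assumes "below a b y"
  shows "0 < b (- y)"
proof -
  have "0 \<le> weight y * a y"
    using nonneg(1)[of y] weight_pos[of y] by simp
  then have "0 < weight (- y) * b (- y)"
    using assms by (simp add: below_def)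
  then show ?thesis
    using weight_pos[of "- y"] by (simp add: zero_less_mult_iff)
qed

lemma below_if_zero_pos:
  assumes "a y = 0" "0 < b (- y)"
  shows "below a b y"
  using assms weight_pos[of "- y"] by (simp add: below_def)

text \<open>
  At most one height is balanced. Both weighted distances are monotone. If the left one is positive
  at a positive height, its weight makes it strictly increasing there; if the right one is positive
  at a negative height, its weight makes it strictly decreasing. One of the two cases applies to
  \<open>y < z\<close>, unless one of the distances vanishes, and then the regions being apart settles
  the comparison.
\<close>

lemma not_below_imp_above:
  assumes "\<not> below a b y" "y < z"
  shows "below b a (- z)"
proof -
  have w: "weight (- y) * b (- y) \<le> weight y * a y"
    using assms(1) by (simp add: below_def)
  have yz: "weight y * a y \<le> weight z * a z"
    using assms(2) by (intro mult_mono weight_mono mono nonneg less_imp_le[OF weight_pos]) auto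
  have zy: "weight (- z) * b (- z) \<le> weight (- z) * b (- y)"
    using assms(2) by (intro mult_left_mono mono less_imp_le[OF weight_pos]) auto
  have zy': "weight (- z) * b (- y) \<le> weight (- y) * b (- y)"
    using assms(2) by (intro mult_right_mono weight_mono nonneg) auto
  have "weight (- z) * b (- z) < weight z * a z"
  proof (cases "b (- y) = 0")
    case True
    then have "0 < a z" using apart[OF assms(2)] by simp
    then have "0 < weight z * a z" using weight_pos[of z] by simp
    moreover have "weight (- z) * b (- z) \<le> 0" using zy True by simp
    ultimately show ?thesis by simp
  next
    case False
    then have b: "0 < b (- y)" using nonneg(2)[of "- y"] by simp
    show ?thesis
    proof (cases "0 < z")
      case True
      have "0 < weight (- y) * b (- y)" using b weight_pos[of "- y"] by simp
      then have "0 < weight y * a y" using w by simp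
      then have "0 < a y" using weight_pos[of y] by (simp add: zero_less_mult_iff)
      then have "0 < a z" using mono(1)[of y z] assms(2) by simp
      have "weight y < weight z" using True assms(2) by (simp add: weight_def max_def)
      have "weight y * a y \<le> weight y * a z"
        using assms(2) by (intro mult_left_mono mono less_imp_le[OF weight_pos]) auto
      also have "\<dots> < weight z * a z"
        using \<open>weight y < weight z\<close> \<open>0 < a z\<close> by (rule mult_strict_right_mono)
      finally show ?thesis using w zy zy' by simp
    next
      case False
      then have "weight (- z) < weight (- y)"
        using assms(2) by (simp add: weight_def max_def)
      then have "weight (- z) * b (- y) < weight (- y) * b (- y)"
        using b by (rule mult_strict_right_mono)
      then show ?thesis using w zy yz by simp
    qed
  qed
  then show ?thesis by (simp add: below_def)
qed

text \<open>
  Some height below the balance point lies outside the lower region. Below \<open>t\<close> the right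
  side of the comparison stays at least \<open>m = b (- t)\<close>, so it suffices to make the left
  side smaller. If the lower region has a top \<open>q\<close>, the left side is small just above
  \<open>q\<close> by the Lipschitz property; otherwise the weight on the right grows without bound as
  the height decreases, while the left side is at most 1.
\<close>

lemma ex_below_pos:
  assumes t: "0 < a t" "0 < b (- t)"
    and threshold: "(\<forall>y. 0 < a y) \<or> (\<exists>q. a q = 0 \<and> (\<forall>y>q. 0 < a y))"
  shows "\<exists>y. below a b y \<and> 0 < a y"
  using threshold
proof (elim disjE exE conjE)
  assume pos: "\<forall>y. 0 < a y"
  define m where "m = b (- t)"
  \<comment> \<open>At this height the right side is at least (1 + 1/m) m, which exceeds 1.\<close>
  define y where "y = min t (- (1 / m))"
  have "0 < m" using t by (simp add: m_def)
  have "y \<le> t" "1 / m \<le> - y" "y \<le> 0"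
    using \<open>0 < m\<close> by (auto simp: y_def min_def) (metis less_le_not_le linorder_le_cases neg_le_0_iff_le order_trans zero_le_divide_1_iff)
  have "weight y * a y \<le> 1"
    using \<open>y \<le> 0\<close> le_1(1)[of y] by (simp add: weight_def)
  also have "1 < (1 + 1 / m) * m"
    using \<open>0 < m\<close> by (simp add: field_simps)
  also have "\<dots> \<le> weight (- y) * b (- y)"
  proof (intro mult_mono)
    show "1 + 1 / m \<le> weight (- y)"
      using \<open>1 / m \<le> - y\<close> by (simp add: weight_def)
    show "m \<le> b (- y)"
      unfolding m_def using \<open>y \<le> t\<close> by (intro mono) simp
  qed (use \<open>0 < m\<close> weight_pos[of "- y"] in auto)
  finally show ?thesis using pos by (auto simp: below_def)
next
  fix q assume q: "a q = 0" "\<forall>y>q. 0 < a y"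
  define m where "m = b (- t)"
  \<comment> \<open>Up to the height t the left side is at most weight t times the distance to q, here at most m / 2.\<close>
  define \<delta> where "\<delta> = min (t - q) (m / (2 * weight t))"
  define y where "y = q + \<delta>"
  have "0 < m" using t by (simp add: m_def)
  have "q < t"
    using t(1) q(1) mono(1)[of t q] by (metis leD not_le_imp_less)
  then have "0 < \<delta>"
    using \<open>0 < m\<close> weight_pos[of t] by (simp add: \<delta>_def)
  have "y \<le> t" by (simp add: y_def \<delta>_def min_def)
  have "a y \<le> \<delta>"
    using shift(1)[of \<delta> q] \<open>0 < \<delta>\<close> q(1) by (simp add: y_def)
  then have "weight y * a y \<le> weight t * (m / (2 * weight t))"
    using \<open>y \<le> t\<close> by (intro mult_mono weight_mono nonneg less_imp_le[OF weight_pos]) (auto simp: \<delta>_def)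
  also have "\<dots> = m / 2"
    using weight_pos[of t] by simp
  also have "m / 2 < m"
    using \<open>0 < m\<close> by simp
  also have "m \<le> b (- y)"
    unfolding m_def using \<open>y \<le> t\<close> by (intro mono) simp
  also have "\<dots> \<le> weight (- y) * b (- y)"
    using mult_right_mono[OF weight_ge_1 nonneg(2)] by simp
  finally have "below a b y" by (simp add: below_def)
  moreover have "0 < a y" using q(2) \<open>0 < \<delta>\<close> by (simp add: y_def)
  ultimately show ?thesis by blast
qed

end

text \<open>
  The supremum \<open>h\<close> of the heights below balance. It respects the bounds \<open>l\<close> and
  \<open>u\<close> since a point of the lower region that is off the upper one is below balance, and
  a height below balance is off the upper region. For \<open>l < u\<close> the heights of
  \<open>ex_below_pos\<close>, on either side, separate \<open>h\<close> strictly from the bounds.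
\<close>

lemma balance_point:
  fixes a b :: "'a::linordered_field \<Rightarrow> 'a" and l u :: "'a extended"
  assumes pair: "distance_pair a b"
    and a_pos: "\<And>y. 0 < a y \<longleftrightarrow> l < Fin y"
    and b_pos: "\<And>y. 0 < b y \<longleftrightarrow> Fin (- y) < u"
    and w: "l \<le> Fin w" "Fin w \<le> u"
    and lub: "\<And>y z. below a b y \<Longrightarrow> \<not> below a b z \<Longrightarrow> \<exists>h. isLub UNIV {y. below a b y} h"
  shows "\<exists>h. (\<forall>y<h. below a b y) \<and> (\<forall>y>h. below b a (- y)) \<and> l \<le> Fin h \<and> Fin h \<le> u \<and>
             (l < u \<longrightarrow> l < Fin h \<and> Fin h < u)"
proof -
  interpret distance_pair a b by fact
  interpret sw: distance_pair b a by (rule swapped)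
  have not_both: "\<not> below a b y" if "below b a (- y)" for y
    using that by (auto simp: below_def)
  have a_threshold: "(\<forall>y. 0 < a y) \<or> (\<exists>q. a q = 0 \<and> (\<forall>y>q. 0 < a y))"
  proof (cases l)
    case (Fin q)
    then have "a q = 0" using a_pos[of q] nonneg(1)[of q] by simp
    then show ?thesis using Fin a_pos by auto
  qed (use w a_pos in auto)
  have b_threshold: "(\<forall>y. 0 < b y) \<or> (\<exists>q. b q = 0 \<and> (\<forall>y>q. 0 < b y))"
  proof (cases u)
    case (Fin q)
    then have "b (- q) = 0" using b_pos[of "- q"] nonneg(2)[of "- q"] by simp
    moreover have "0 < b y" if "- q < y" for y
      using that Fin b_pos[of y] minus_less_iff by simp
    ultimately show ?thesis by blast
  qed (use w b_pos in auto)
  have strict: "\<exists>y z. below a b y \<and> l < Fin y \<and> below b a (- z) \<and> Fin z < u" if "l < u"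
  proof -
    obtain t where "l < Fin t" "Fin t < u"
    proof (cases l; cases u)
      fix p q assume "l = Fin p" "u = Fin q"
      then show ?thesis using that[of "(p + q) / 2"] \<open>l < u\<close> by (auto simp: field_simps)
    next
      fix p assume "l = Fin p" "u = Pinf"
      then show ?thesis using that[of "p + 1"] by auto
    next
      fix q assume "l = Minf" "u = Fin q"
      then show ?thesis using that[of "q - 1"] by auto
    next
      assume "l = Minf" "u = Pinf"
      then show ?thesis using that[of 0] by auto
    qed (use w \<open>l < u\<close> in auto)
    then have t: "0 < a t" "0 < b (- t)" by (simp_all add: a_pos b_pos)
    obtain y where y: "below a b y" "0 < a y"
      using ex_below_pos[OF t a_threshold] by blast
    obtain z where z: "below b a z" "0 < b z"
      using sw.ex_below_pos[of "- t", OF _ _ b_threshold] t by auto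
    have "below b a (- (- z))" "Fin (- z) < u" using z b_pos by auto
    then show ?thesis using y a_pos by blast
  qed
  have "\<exists>y z. below a b y \<and> \<not> below a b z"
  proof (cases "l < u")
    case True
    then show ?thesis using strict not_both by blast
  next
    case False
    then have eq: "l = Fin w" "u = Fin w" using w by auto
    have "below a b (w - 1)"
      using a_pos[of "w - 1"] nonneg(1)[of "w - 1"] b_pos[of "- (w - 1)"]
      by (intro below_if_zero_pos) (auto simp: eq)
    moreover have "\<not> below a b w"
      using below_imp_pos[of w] b_pos[of "- w"] by (auto simp: eq)
    ultimately show ?thesis by blast
  qed
  then obtain h where h: "isLub UNIV {y. below a b y} h" using lub by blast
  have low: "below a b y" if "y < h" for y
  proof (rule ccontr)
    assume "\<not> below a b y"
    then have "z \<le> y" if "below a b z" for z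
      using that below_downward by (meson linorder_le_cases)
    then have "h \<le> y"
      by (intro isLub_le_isUb[OF h] isUbI setleI) auto
    then show False using that by simp
  qed
  have high: "below b a (- y)" if "h < y" for y
  proof -
    define m where "m = (h + y) / 2"
    have "h < m" "m < y" using that by (auto simp: m_def field_simps)
    have "\<not> below a b m"
      using isLubD2[OF h, of m] \<open>h < m\<close> by auto
    then show ?thesis using \<open>m < y\<close> by (rule not_below_imp_above)
  qed
  have "l \<le> Fin h"
  proof (cases l)
    case (Fin q)
    have "y \<le> h" if "y < q" for y
    proof -
      have "a y = 0" using a_pos[of y] nonneg(1)[of y] that Fin by simp
      moreover have "Fin y < u"
        using that w Fin by (metis less_extended_simps(1) order_less_le_trans)
      ultimately have "below a b y" using b_pos[of "- y"] by (intro below_if_zero_pos) auto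
      then show ?thesis using isLubD2[OF h] by simp
    qed
    then show ?thesis using Fin by (simp add: dense_le)
  qed (use w in auto)
  moreover have "Fin h \<le> u"
  proof (cases u)
    case (Fin q)
    have "y \<le> q" if "below a b y" for y
      using below_imp_pos[OF that] b_pos[of "- y"] Fin by simp
    then show ?thesis
      using isLub_le_isUb[OF h] Fin by (auto simp: isUb_def setle_def)
  qed (use w in auto)
  moreover have "l < Fin h \<and> Fin h < u" if lu: "l < u"
  proof -
    obtain y z where yz: "below a b y" "l < Fin y" "below b a (- z)" "Fin z < u"
      using strict[OF lu] by blast
    have "y \<le> h" using isLubD2[OF h] yz by simp
    moreover have "h \<le> z"
      using low[of z] not_both[OF yz(3)] by (meson not_le_imp_less)
    ultimately show ?thesis using yz
      by (metis less_eq_extended.simps(1) order_le_less_trans order_less_le_trans)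
  qed
  ultimately show ?thesis using low high by blast
qed

section \<open>Distance to the region that a moving cut forbids\<close>

text \<open>
  The open box of radius \<open>r\<close>. For \<open>n = 0\<close> it is everything, even when
  \<open>r\<close> is not positive.
\<close>

definition near :: "nat \<Rightarrow> 'a::linordered_field \<Rightarrow> (nat \<Rightarrow> 'a) \<Rightarrow> (nat \<Rightarrow> 'a) \<Rightarrow> bool" where
  "near n r x z \<longleftrightarrow> (\<forall>i<n. \<bar>x i - z i\<bar> < r)"

lemma near_sym: "near n r x z \<longleftrightarrow> near n r z x"
  by (simp add: near_def abs_minus_commute)

lemma near_mono: "near n r x z \<Longrightarrow> r \<le> s \<Longrightarrow> near n s x z"
  by (auto simp: near_def intro: less_le_trans)

lemma near_triangle:
  assumes "near n r x y" "near n s y z"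
  shows "near n (r + s) x z"
  unfolding near_def
proof (intro allI impI)
  fix i assume "i < n"
  then have "\<bar>x i - y i\<bar> < r" "\<bar>y i - z i\<bar> < s"
    using assms by (auto simp: near_def)
  then show "\<bar>x i - z i\<bar> < r + s" by linarith
qed

lemma near_self: "0 < r \<Longrightarrow> near n r x x"
  by (simp add: near_def)

text \<open>
  The predicate \<open>c z t\<close> says that the region over \<open>z\<close> has no points above height
  \<open>t\<close>, as \<open>f z \<le> Fin t\<close> does for the region below the graph of
  \<open>f\<close>. Then \<open>r > 0\<close> is a clear radius iff the open sup-norm ball of radius
  \<open>r\<close> around \<open>(x, y)\<close> misses the region. All \<open>r \<le> 0\<close> are
  included, so that the set is nonempty and its supremum at least 0 also when no ball is clear; the
  bound 1 keeps the supremum finite when the region is empty.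
\<close>

definition clear_radii ::
  "nat \<Rightarrow> (nat \<Rightarrow> 'a::linordered_field) set \<Rightarrow> ((nat \<Rightarrow> 'a) \<Rightarrow> 'a \<Rightarrow> bool) \<Rightarrow>
     (nat \<Rightarrow> 'a) \<Rightarrow> 'a \<Rightarrow> 'a set" where
  "clear_radii n E c x y = {r. r \<le> 1 \<and> (0 < r \<longrightarrow> (\<forall>z\<in>E. near n r x z \<longrightarrow> c z (y - r)))}"

definition clearance ::
  "nat \<Rightarrow> (nat \<Rightarrow> 'a::linordered_field) set \<Rightarrow> ((nat \<Rightarrow> 'a) \<Rightarrow> 'a \<Rightarrow> bool) \<Rightarrow>
     (nat \<Rightarrow> 'a) \<Rightarrow> 'a \<Rightarrow> 'a" where
  "clearance n E c x y = (THE d. isLub UNIV (clear_radii n E c x y) d)"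

lemma clearance_cong:
  "(\<And>i. i < n \<Longrightarrow> v i = w i) \<Longrightarrow> clearance n E c v = clearance n E c w"
  by (simp add: clearance_def clear_radii_def near_def fun_eq_iff)

text \<open>
  Working with \<open>c\<close> rather than with an extended-valued function treats both graphs alike:
  the region above the graph of \<open>g\<close>, turned upside down, is given by
  \<open>Fin (- t) \<le> g z\<close>.
\<close>

locale semicontinuous_cut =
  fixes n :: nat and E :: "(nat \<Rightarrow> 'a::linordered_field) set" and c :: "(nat \<Rightarrow> 'a) \<Rightarrow> 'a \<Rightarrow> bool"
  assumes upward: "c x t \<Longrightarrow> t \<le> t' \<Longrightarrow> c x t'"
    and nearby: "x \<in> E \<Longrightarrow> c x t \<Longrightarrow> t < t' \<Longrightarrow> \<exists>\<delta>>0. \<forall>z\<in>E. near n \<delta> x z \<longrightarrow> c z t'"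
    and lub: "\<exists>d. isLub UNIV (clear_radii n E c x y) d"
begin

abbreviation radii where "radii \<equiv> clear_radii n E c"
abbreviation clr where "clr \<equiv> clearance n E c"

lemma clr_isLub: "isLub UNIV (radii x y) (clr x y)"
  using lub[of x y] unfolding clearance_def by (metis isLub_unique theI)

lemma clr_upper: "r \<in> radii x y \<Longrightarrow> r \<le> clr x y"
  using isLubD2[OF clr_isLub] .

lemma clr_least: "(\<And>r. r \<in> radii x y \<Longrightarrow> r \<le> b) \<Longrightarrow> clr x y \<le> b"
  by (rule isLub_le_isUb[OF clr_isLub isUb_UNIV_I])

lemma clr_nonneg: "0 \<le> clr x y"
  by (rule clr_upper) (simp add: clear_radii_def)

lemma clr_le_1: "clr x y \<le> 1"
  by (rule clr_least) (simp add: clear_radii_def)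

lemma radii_downward:
  assumes "r \<in> radii x y" "s \<le> r"
  shows "s \<in> radii x y"
  unfolding clear_radii_def
proof (intro CollectI conjI impI ballI)
  show "s \<le> 1" using assms by (simp add: clear_radii_def)
  fix z assume "0 < s" "z \<in> E" "near n s x z"
  then have "c z (y - r)"
    using assms near_mono[of n s x z r] by (simp add: clear_radii_def)
  then show "c z (y - s)" by (rule upward) (use assms(2) in simp)
qed

lemma less_clr_imp_radius: "r < clr x y \<Longrightarrow> r \<in> radii x y"
  using clr_least[of x y r] radii_downward by (meson linorder_le_cases not_le)

lemma clr_mono:
  assumes "y \<le> y'"
  shows "clr x y \<le> clr x y'"
proof (intro clr_least clr_upper)
  fix r assume "r \<in> radii x y"
  moreover have "y - r \<le> y' - r" using assms by simp
  ultimately show "r \<in> radii x y'"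
    unfolding clear_radii_def using upward by blast
qed

text \<open>
  A ball of radius \<open>r\<close> contains the ball of radius \<open>r - \<delta>\<close> around every
  point at distance at most \<open>\<delta>\<close> from its centre, so clearances are 1-Lipschitz:
  vertically here, and horizontally in \<open>clr_near\<close>.
\<close>

lemma clr_shift:
  assumes "0 \<le> \<delta>"
  shows "clr x (y + \<delta>) \<le> clr x y + \<delta>"
proof (rule clr_least)
  fix r assume r: "r \<in> radii x (y + \<delta>)"
  have "r - \<delta> \<in> radii x y"
    unfolding clear_radii_def
  proof (intro CollectI conjI impI ballI)
    show "r - \<delta> \<le> 1" using assms r by (simp add: clear_radii_def)
    fix z assume z: "0 < r - \<delta>" "z \<in> E" "near n (r - \<delta>) x z"
    then have "near n r x z" using near_mono[OF z(3)] assms by simp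
    then have "c z (y + \<delta> - r)" using r z assms by (simp add: clear_radii_def)
    then show "c z (y - (r - \<delta>))" by (simp add: algebra_simps)
  qed
  then show "r \<le> clr x y + \<delta>" using clr_upper by fastforce
qed

lemma clr_near:
  assumes "0 \<le> \<delta>" "near n \<delta> x x'"
  shows "clr x y \<le> clr x' y + \<delta>"
proof (rule clr_least)
  fix r assume r: "r \<in> radii x y"
  have "r - \<delta> \<in> radii x' y"
    unfolding clear_radii_def
  proof (intro CollectI conjI impI ballI)
    show "r - \<delta> \<le> 1" using assms r by (simp add: clear_radii_def)
    fix z assume z: "0 < r - \<delta>" "z \<in> E" "near n (r - \<delta>) x' z"
    then have "near n r x z" using near_triangle[OF assms(2) z(3)] by simp
    then have "c z (y - r)" using r z assms by (simp add: clear_radii_def)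
    then show "c z (y - (r - \<delta>))" using assms(1) by (rule_tac upward) auto
  qed
  then show "r \<le> clr x' y + \<delta>" using clr_upper by fastforce
qed

text \<open>
  A point has positive clearance iff it lies strictly above the region. Semicontinuity is what
  provides a clear ball: just below \<open>y\<close> there is a height that bounds the region over a
  whole neighbourhood of \<open>x\<close>.
\<close>

lemma clr_pos_iff:
  assumes "x \<in> E"
  shows "0 < clr x y \<longleftrightarrow> (\<exists>t<y. c x t)"
proof
  assume pos: "0 < clr x y"
  then have "clr x y / 2 \<in> radii x y"
    by (intro less_clr_imp_radius) simp
  then have "c x (y - clr x y / 2)"
    using pos assms near_self[of "clr x y / 2" n x] by (simp add: clear_radii_def)
  then show "\<exists>t<y. c x t" using pos by (intro exI[of _ "y - clr x y / 2"]) simp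
next
  assume "\<exists>t<y. c x t"
  then obtain t where t: "t < y" "c x t" by blast
  define s where "s = (t + y) / 2"
  have s: "t < s" "s < y" using t by (auto simp: s_def field_simps)
  obtain \<delta> where \<delta>: "0 < \<delta>" "\<And>z. z \<in> E \<Longrightarrow> near n \<delta> x z \<Longrightarrow> c z s"
    using nearby[OF assms t(2) s(1)] by blast
  define r where "r = min \<delta> (min (y - s) 1)"
  have r: "0 < r" "r \<le> \<delta>" "s \<le> y - r" "r \<le> 1"
    using \<delta>(1) s by (auto simp: r_def min_def)
  have "r \<in> radii x y"
    unfolding clear_radii_def
  proof (intro CollectI conjI impI ballI)
    fix z assume "z \<in> E" "near n r x z"
    then have "c z s" using \<delta>(2) near_mono r(2) by blast
    then show "c z (y - r)" using r(3) by (rule upward)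
  qed (use r in auto)
  then show "0 < clr x y" using clr_upper r(1) by fastforce
qed

end

text \<open>
  Moving \<open>x\<close> by \<open>\<delta>\<close> changes each distance by at most \<open>\<delta>\<close>,
  and \<open>\<delta>\<close> is chosen such that the weighted changes together stay below the gap
  \<open>\<epsilon>\<close> in the strict inequality at \<open>x\<close>.
\<close>

lemma below_nearby:
  assumes "semicontinuous_cut n E c" "semicontinuous_cut n E d"
    and "below (clearance n E c x) (clearance n E d x) y"
  shows "\<exists>\<delta>>0. \<forall>x'. near n \<delta> x x' \<longrightarrow> below (clearance n E c x') (clearance n E d x') y"
proof -
  interpret c: semicontinuous_cut n E c by fact
  interpret d: semicontinuous_cut n E d by fact
  define \<epsilon> where "\<epsilon> = weight (- y) * d.clr x (- y) - weight y * c.clr x y"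
  define W where "W = weight y + weight (- y)"
  define \<delta> where "\<delta> = \<epsilon> / (2 * W)"
  have W: "0 < W"
    using weight_pos[of y] weight_pos[of "- y"] by (simp add: W_def)
  have "0 < \<epsilon>" using assms(3) by (simp add: below_def \<epsilon>_def)
  then have "0 < \<delta>" using W by (simp add: \<delta>_def)
  have "\<delta> * W = \<epsilon> / 2"
    using W by (simp add: \<delta>_def)
  then have \<delta>: "weight y * \<delta> + weight (- y) * \<delta> < \<epsilon>"
    using \<open>0 < \<epsilon>\<close> by (simp add: W_def algebra_simps)
  have "below (c.clr x') (d.clr x') y" if "near n \<delta> x x'" for x'
  proof -
    have "c.clr x' y \<le> c.clr x y + \<delta>"
      using c.clr_near that \<open>0 < \<delta>\<close> by (simp add: near_sym)
    from mult_left_mono[OF this less_imp_le[OF weight_pos[of y]]]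
    have "weight y * c.clr x' y \<le> weight y * c.clr x y + weight y * \<delta>"
      by (simp add: algebra_simps)
    moreover have "d.clr x (- y) \<le> d.clr x' (- y) + \<delta>"
      using d.clr_near that \<open>0 < \<delta>\<close> by simp
    from mult_left_mono[OF this less_imp_le[OF weight_pos[of "- y"]]]
    have "weight (- y) * d.clr x (- y) \<le> weight (- y) * d.clr x' (- y) + weight (- y) * \<delta>"
      by (simp add: algebra_simps)
    ultimately show ?thesis using \<delta> unfolding below_def \<epsilon>_def by linarith
  qed
  then show ?thesis using \<open>0 < \<delta>\<close> by blast
qed

text \<open>
  Eliminates the suprema, which leaves a condition that a formula can express: a strict inequality
  between the distances is witnessed by a radius too large for the one and a radius clear for the
  other.
\<close>

lemma below_iff_radii:
  assumes "semicontinuous_cut n E c" "semicontinuous_cut n E d"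
  shows "below (clearance n E c x) (clearance n E d x) y \<longleftrightarrow>
    (\<exists>r s. r \<notin> clear_radii n E c x y \<and> s \<in> clear_radii n E d x (- y) \<and>
           weight y * r < weight (- y) * s)"
proof -
  interpret c: semicontinuous_cut n E c by fact
  interpret d: semicontinuous_cut n E d by fact
  show ?thesis
  proof
    assume "below (c.clr x) (d.clr x) y"
    then have "weight y * c.clr x y / weight (- y) < d.clr x (- y)"
      using weight_pos[of "- y"] by (simp add: below_def field_simps)
    then obtain s where s: "weight y * c.clr x y / weight (- y) < s" "s < d.clr x (- y)"
      using dense by blast
    then have "c.clr x y < weight (- y) * s / weight y"
      using weight_pos[of y] weight_pos[of "- y"] by (simp add: field_simps)
    then obtain r where r: "c.clr x y < r" "r < weight (- y) * s / weight y"
      using dense by blast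
    have "r \<notin> c.radii x y" using c.clr_upper[of r x y] r by auto
    moreover have "s \<in> d.radii x (- y)" using s(2) by (rule d.less_clr_imp_radius)
    moreover have "weight y * r < weight (- y) * s"
      using r(2) weight_pos[of y] by (simp add: field_simps)
    ultimately show "\<exists>r s. r \<notin> c.radii x y \<and> s \<in> d.radii x (- y) \<and>
        weight y * r < weight (- y) * s" by blast
  next
    assume "\<exists>r s. r \<notin> c.radii x y \<and> s \<in> d.radii x (- y) \<and> weight y * r < weight (- y) * s"
    then obtain r s where rs: "r \<notin> c.radii x y" "s \<in> d.radii x (- y)"
      "weight y * r < weight (- y) * s" by blast
    have "c.clr x y \<le> r" using c.less_clr_imp_radius[of r x y] rs(1) by (meson not_le)
    then have "weight y * c.clr x y \<le> weight y * r"
      using weight_pos[of y] by simp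
    moreover have "weight (- y) * s \<le> weight (- y) * d.clr x (- y)"
      using d.clr_upper[OF rs(2)] weight_pos[of "- y"] by simp
    ultimately show "below (c.clr x) (d.clr x) y"
      using rs(3) by (simp add: below_def)
  qed
qed

section \<open>Boxes generate the subspace topology\<close>

lemma open_contains_symmetric_interval:
  fixes x :: "'a::{linordered_field, linorder_topology}"
  assumes "open V" "x \<in> V"
  shows "\<exists>\<delta>>0. \<forall>t. \<bar>x - t\<bar> < \<delta> \<longrightarrow> t \<in> V"
proof -
  obtain b where b: "x < b" "{x..<b} \<subseteq> V"
    using open_right[OF assms, of "x + 1"] by auto
  obtain a where a: "a < x" "{a<..x} \<subseteq> V"
    using open_left[OF assms, of "x - 1"] by auto
  have "t \<in> V" if "\<bar>x - t\<bar> < min (x - a) (b - x)" for t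
  proof (cases "t \<le> x")
    case True
    then have "t \<in> {a<..x}" using that by auto
    then show ?thesis using a(2) by blast
  next
    case False
    then have "t \<in> {x..<b}" using that by (auto simp: abs_if split: if_splits)
    then show ?thesis using b(2) by blast
  qed
  then show ?thesis using a(1) b(1) by (intro exI[of _ "min (x - a) (b - x)"]) auto
qed

lemma ex_common_radius:
  fixes \<epsilon> :: "nat \<Rightarrow> 'a::linordered_field"
  assumes "\<And>i. i < n \<Longrightarrow> 0 < \<epsilon> i"
  shows "\<exists>\<delta>>0. \<forall>i<n. \<delta> \<le> \<epsilon> i"
  using assms
proof (induction n)
  case 0
  then show ?case by (intro exI[of _ 1]) simp
next
  case (Suc n)
  then obtain \<delta> where "0 < \<delta>" "\<forall>i<n. \<delta> \<le> \<epsilon> i" by auto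
  then show ?case
    using Suc.prems by (intro exI[of _ "min \<delta> (\<epsilon> n)"]) (auto simp: less_Suc_eq min_le_iff_disj)
qed

lemma open_box_contains_near:
  fixes V :: "nat \<Rightarrow> 'a::{linordered_field, linorder_topology} set"
  assumes "\<And>i. i < n \<Longrightarrow> open (V i)" "x \<in> Pi\<^sub>E {..<n} V"
  shows "\<exists>\<delta>>0. \<forall>z\<in>power_space n. near n \<delta> x z \<longrightarrow> z \<in> Pi\<^sub>E {..<n} V"
proof -
  have "\<exists>\<epsilon>>0. \<forall>t. \<bar>x i - t\<bar> < \<epsilon> \<longrightarrow> t \<in> V i" if "i < n" for i
    using assms that by (intro open_contains_symmetric_interval) auto
  then obtain \<epsilon> where \<epsilon>: "\<And>i. i < n \<Longrightarrow> 0 < \<epsilon> i"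
    "\<And>i t. i < n \<Longrightarrow> \<bar>x i - t\<bar> < \<epsilon> i \<Longrightarrow> t \<in> V i"
    by metis
  obtain \<delta> where \<delta>: "0 < \<delta>" "\<And>i. i < n \<Longrightarrow> \<delta> \<le> \<epsilon> i"
    using ex_common_radius[of n \<epsilon>] \<epsilon>(1) by blast
  have "z \<in> Pi\<^sub>E {..<n} V" if z: "z \<in> power_space n" "near n \<delta> x z" for z
  proof (rule PiE_I)
    fix i assume "i \<in> {..<n}"
    then have i: "i < n" by simp
    then have "\<bar>x i - z i\<bar> < \<delta>" using z(2) by (simp add: near_def)
    then have "\<bar>x i - z i\<bar> < \<epsilon> i" using \<delta>(2)[OF i] by (rule less_le_trans)
    then show "z i \<in> V i" by (rule \<epsilon>(2)[OF i])
  next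
    fix i assume "i \<notin> {..<n}"
    then show "z i = undefined" using z(1) unfolding power_space_def by (rule PiE_arb[rotated])
  qed
  then show ?thesis using \<delta>(1) by blast
qed

lemma near_eq_box:
  "{z \<in> power_space n. near n \<delta> x z} = Pi\<^sub>E {..<n} (\<lambda>i. {x i - \<delta><..<x i + \<delta>})"
  (is "?L = ?R")
proof (intro set_eqI iffI)
  have abs: "\<bar>a - b\<bar> < \<delta> \<longleftrightarrow> a - \<delta> < b \<and> b < a + \<delta>" for a b
    by linarith
  fix z
  show "z \<in> ?R" if "z \<in> ?L"
    using that by (simp add: power_space_def PiE_iff near_def abs)
  show "z \<in> ?L" if "z \<in> ?R"
    using that by (simp add: power_space_def PiE_iff near_def abs)
qed

lemma openin_subspace_top_iff:
  fixes E :: "(nat \<Rightarrow> 'a::{linordered_field, linorder_topology}) set"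
  assumes "E \<subseteq> power_space n"
  shows "openin (subspace_top n E) U \<longleftrightarrow>
    U \<subseteq> E \<and> (\<forall>x\<in>U. \<exists>\<delta>>0. \<forall>z\<in>E. near n \<delta> x z \<longrightarrow> z \<in> U)"
proof
  assume "openin (subspace_top n E) U"
  then obtain T where T: "openin (product_topology (\<lambda>_. euclidean) {..<n}) T" "U = T \<inter> E"
    unfolding subspace_top_def openin_subtopology by blast
  have "\<exists>\<delta>>0. \<forall>z\<in>E. near n \<delta> x z \<longrightarrow> z \<in> U" if "x \<in> U" for x
  proof -
    have "x \<in> T" using T(2) that by blast
    from bspec[OF T(1)[unfolded openin_product_topology_alt] this]
    obtain V where V: "\<forall>i\<in>{..<n}. openin euclidean (V i)"
      "x \<in> Pi\<^sub>E {..<n} V" "Pi\<^sub>E {..<n} V \<subseteq> T"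
      by (elim exE conjE)
    have "\<exists>\<delta>>0. \<forall>z\<in>power_space n. near n \<delta> x z \<longrightarrow> z \<in> Pi\<^sub>E {..<n} V"
      by (rule open_box_contains_near[OF _ V(2)]) (use V(1) in simp)
    then obtain \<delta> where \<delta>: "0 < \<delta>" "\<forall>z\<in>power_space n. near n \<delta> x z \<longrightarrow> z \<in> Pi\<^sub>E {..<n} V"
      by (elim exE conjE)
    have "z \<in> U" if "z \<in> E" "near n \<delta> x z" for z
    proof -
      have "z \<in> Pi\<^sub>E {..<n} V" using \<delta>(2) assms that by auto
      then show ?thesis using T(2) V(3) that(1) by auto
    qed
    then show ?thesis using \<delta>(1) by (intro exI[of _ \<delta>]) simp
  qed
  moreover have "U \<subseteq> E" using T(2) by simp
  ultimately show "U \<subseteq> E \<and> (\<forall>x\<in>U. \<exists>\<delta>>0. \<forall>z\<in>E. near n \<delta> x z \<longrightarrow> z \<in> U)"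
    by simp
next
  assume U: "U \<subseteq> E \<and> (\<forall>x\<in>U. \<exists>\<delta>>0. \<forall>z\<in>E. near n \<delta> x z \<longrightarrow> z \<in> U)"
  have "\<exists>T. openin (subspace_top n E) T \<and> x \<in> T \<and> T \<subseteq> U" if x: "x \<in> U" for x
  proof -
    obtain \<delta> where \<delta>: "0 < \<delta>" "\<And>z. z \<in> E \<Longrightarrow> near n \<delta> x z \<Longrightarrow> z \<in> U"
      using U x by blast
    define B where "B = {z \<in> power_space n. near n \<delta> x z}"
    have "openin (product_topology (\<lambda>_. euclidean) {..<n}) B"
      unfolding B_def near_eq_box by (simp add: openin_PiE)
    then have "openin (subspace_top n E) (B \<inter> E)"
      unfolding subspace_top_def openin_subtopology by (intro exI[of _ B]) simp
    moreover have "x \<in> B \<inter> E"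
      using x U assms near_self[OF \<delta>(1)] by (auto simp: B_def)
    moreover have "B \<inter> E \<subseteq> U"
      using \<delta>(2) by (auto simp: B_def)
    ultimately show ?thesis by (intro exI[of _ "B \<inter> E"]) simp
  qed
  then show "openin (subspace_top n E) U"
    using openin_subopen[of "subspace_top n E" U] by simp
qed

lemma topspace_subspace_top:
  fixes E :: "(nat \<Rightarrow> 'a::topological_space) set"
  assumes "E \<subseteq> power_space n"
  shows "topspace (subspace_top n E) = E"
  using assms by (auto simp: subspace_top_def power_space_def)

lemma continuous_map_if_locally_bounded:
  fixes h :: "(nat \<Rightarrow> 'a::{linordered_field, linorder_topology}) \<Rightarrow> 'a"
  assumes E: "E \<subseteq> power_space n"
    and lower: "\<And>x y. x \<in> E \<Longrightarrow> y < h x \<Longrightarrow> \<exists>\<delta>>0. \<forall>z\<in>E. near n \<delta> x z \<longrightarrow> y < h z"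
    and upper: "\<And>x y. x \<in> E \<Longrightarrow> h x < y \<Longrightarrow> \<exists>\<delta>>0. \<forall>z\<in>E. near n \<delta> x z \<longrightarrow> h z < y"
  shows "continuous_map (subspace_top n E) euclidean h"
  unfolding continuous_map_def
proof (intro conjI allI impI)
  fix V :: "'a set" assume "openin euclidean V"
  then have V: "open V" by simp
  have "\<exists>\<delta>>0. \<forall>z\<in>E. near n \<delta> x z \<longrightarrow> h z \<in> V" if x: "x \<in> E" "h x \<in> V" for x
  proof -
    obtain \<epsilon> where \<epsilon>: "0 < \<epsilon>" "\<And>t. \<bar>h x - t\<bar> < \<epsilon> \<Longrightarrow> t \<in> V"
      using open_contains_symmetric_interval[OF V x(2)] by blast
    obtain \<delta> where \<delta>: "0 < \<delta>" "\<forall>z\<in>E. near n \<delta> x z \<longrightarrow> h x - \<epsilon> < h z"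
      using lower[OF x(1), of "h x - \<epsilon>"] \<epsilon>(1) by auto
    obtain \<delta>' where \<delta>': "0 < \<delta>'" "\<forall>z\<in>E. near n \<delta>' x z \<longrightarrow> h z < h x + \<epsilon>"
      using upper[OF x(1), of "h x + \<epsilon>"] \<epsilon>(1) by auto
    have "h z \<in> V" if "z \<in> E" "near n (min \<delta> \<delta>') x z" for z
    proof (rule \<epsilon>(2))
      have "h x - \<epsilon> < h z" "h z < h x + \<epsilon>"
        using \<delta>(2) \<delta>'(2) that near_mono[OF that(2)] by auto
      then show "\<bar>h x - h z\<bar> < \<epsilon>" by linarith
    qed
    then show ?thesis using \<delta>(1) \<delta>'(1) by (intro exI[of _ "min \<delta> \<delta>'"]) auto
  qed
  then show "openin (subspace_top n E) {x \<in> topspace (subspace_top n E). h x \<in> V}"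
    unfolding openin_subspace_top_iff[OF E] topspace_subspace_top[OF E] by auto
qed auto

section \<open>Definability of the clearance\<close>

text \<open>
  The variables \<open>n\<close> and \<open>n + 1\<close> hold \<open>y\<close> and \<open>r\<close>. The
  quantified block consists of \<open>n + 2\<close>, which holds the height \<open>y - r\<close>
  (subtraction is no term, so an equation fixes it), and of the \<open>n\<close> coordinates of
  \<open>z\<close>, which start at \<open>n + 3\<close>.
\<close>

lemma definable_pred_clear_radii:
  assumes E: "definable_pred S n (\<lambda>v. restrict v {..<n} \<in> E)" "E \<subseteq> power_space n"
    and c: "definable_pred S (Suc n) (\<lambda>v. c (restrict v {..<n}) (v n))"
  shows "definable_pred S (n + 2) (\<lambda>v. v (n + 1) \<in> clear_radii n E c v (v n))"
proof -
  let ?z = "\<lambda>v :: nat \<Rightarrow> 'a. restrict (\<lambda>i. v (i + (n + 3))) {..<n}"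
  let ?Q = "\<lambda>v :: nat \<Rightarrow> 'a. ?z v \<in> E \<longrightarrow>
      (\<forall>i<n. v i < v (i + (n + 3)) + v (n + 1) \<and> v (i + (n + 3)) < v i + v (n + 1)) \<longrightarrow>
      v (n + 2) + v (n + 1) = v n \<longrightarrow> c (?z v) (v (n + 2))"
  let ?mix = "\<lambda>(v :: nat \<Rightarrow> 'a) w i. if i < n + 2 then v i else w i"
  have dE: "definable_pred S (n + 2 + (n + 1)) (\<lambda>v. ?z v \<in> E)"
    using definable_pred_rename[OF E(1), of "\<lambda>i. i + (n + 3)" "n + 2 + (n + 1)"]
    by (simp add: inj_on_def)
  let ?\<rho> = "\<lambda>i. if i < n then i + (n + 3) else n + 2"
  have "definable_pred S (n + 2 + (n + 1)) (\<lambda>v. c (restrict (\<lambda>i. v (?\<rho> i)) {..<n}) (v (?\<rho> n)))"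
    by (rule definable_pred_rename[OF c, of ?\<rho>]) (auto simp: inj_on_def less_Suc_eq)
  moreover have "restrict (\<lambda>i. v (?\<rho> i)) {..<n} = ?z v" for v :: "nat \<Rightarrow> 'a"
    by (auto simp: fun_eq_iff)
  ultimately have dc: "definable_pred S (n + 2 + (n + 1)) (\<lambda>v. c (?z v) (v (n + 2)))"
    by (simp only: less_irrefl if_False)
  have "definable_pred S (n + 2 + (n + 1)) ?Q"
    by (intro definable_pred_intros dE dc) auto
  from definable_pred_all_block[OF this]
  have all: "definable_pred S (n + 2) (\<lambda>v. \<forall>w. ?Q (?mix v w))" .
  have close: "\<bar>a - b\<bar> < r \<longleftrightarrow> a < b + r \<and> b < a + r" for a b r :: 'a
    by linarith
  have "(\<forall>w. ?Q (?mix v w)) \<longleftrightarrow>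
      (\<forall>z\<in>E. near n (v (n + 1)) v z \<longrightarrow> c z (v n - v (n + 1)))" for v
  proof
    assume all: "\<forall>w. ?Q (?mix v w)"
    show "\<forall>z\<in>E. near n (v (n + 1)) v z \<longrightarrow> c z (v n - v (n + 1))"
    proof (intro ballI impI)
      fix z assume z: "z \<in> E" "near n (v (n + 1)) v z"
      define w where "w = (\<lambda>i. if i = n + 2 then v n - v (n + 1) else z (i - (n + 3)))"
      have "z \<in> power_space n" using z(1) E(2) by blast
      then have "?z (?mix v w) = z"
        by (auto simp: w_def power_space_def PiE_def extensional_def fun_eq_iff)
      moreover have "?Q (?mix v w)" using all by (rule spec)
      ultimately have "?z (?mix v w) = z \<and> ?Q (?mix v w)" by blast
      then show "c z (v n - v (n + 1))"
        using z by (auto simp: w_def near_def close)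
    qed
  next
    assume "\<forall>z\<in>E. near n (v (n + 1)) v z \<longrightarrow> c z (v n - v (n + 1))"
    then have *: "c z t" if "z \<in> E" "near n (v (n + 1)) v z" "t + v (n + 1) = v n" for z t
      using that by (simp flip: that(3))
    show "\<forall>w. ?Q (?mix v w)"
      by (intro allI impI *) (simp_all add: near_def close)
  qed
  then have *: "definable_pred S (n + 2)
      (\<lambda>v. \<forall>z\<in>E. near n (v (n + 1)) v z \<longrightarrow> c z (v n - v (n + 1)))"
    using all by simp
  show ?thesis
    unfolding clear_radii_def mem_Collect_eq
    by (intro definable_pred_intros *) auto
qed

text \<open>
  The variables \<open>n + 1\<close> and \<open>n + 2\<close> hold the two witnessing radii of
  \<open>below_iff_radii\<close>, and \<open>n + 3\<close> holds the negated height. The weights are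
  resolved by the sign of the height.
\<close>

lemma definable_pred_below:
  assumes c: "semicontinuous_cut n E c"
      "definable_pred S (n + 2) (\<lambda>v. v (n + 1) \<in> clear_radii n E c v (v n))"
    and d: "semicontinuous_cut n E d"
      "definable_pred S (n + 2) (\<lambda>v. v (n + 1) \<in> clear_radii n E d v (v n))"
  shows "definable_pred S (Suc n) (\<lambda>v. below (clearance n E c v) (clearance n E d v) (v n))"
proof -
  have radii: "definable_pred S (Suc n + 3) (\<lambda>v. v k \<in> clear_radii n E e v (v j))"
    if "definable_pred S (n + 2) (\<lambda>v. v (n + 1) \<in> clear_radii n E e v (v n))"
      "n \<le> j" "n \<le> k" "j \<noteq> k" "j < n + 4" "k < n + 4" for e j k
  proof -
    let ?\<rho> = "\<lambda>i. if i < n then i else if i = n then j else k"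
    have "definable_pred S (Suc n + 3)
        (\<lambda>v. v k \<in> clear_radii n E e (\<lambda>i. v (?\<rho> i)) (v j))"
      using definable_pred_rename[OF that(1), of ?\<rho> "Suc n + 3"] that(2-)
      by (auto simp: inj_on_def)
    moreover have "clear_radii n E e (\<lambda>i. v (?\<rho> i)) y = clear_radii n E e v y" for v y
      by (simp add: clear_radii_def near_def)
    ultimately show ?thesis by simp
  qed
  let ?Q = "\<lambda>v :: nat \<Rightarrow> 'a. v (n + 3) + v n = 0 \<and>
      \<not> v (n + 1) \<in> clear_radii n E c v (v n) \<and>
      v (n + 2) \<in> clear_radii n E d v (v (n + 3)) \<and>
      (0 \<le> v n \<and> (1 + v n) * v (n + 1) < v (n + 2) \<or>
       v n < 0 \<and> v (n + 1) < (1 + v (n + 3)) * v (n + 2))"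
  let ?mix = "\<lambda>(v :: nat \<Rightarrow> 'a) w i. if i < Suc n then v i else w i"
  have "definable_pred S (Suc n + 3) ?Q"
    by (intro definable_pred_intros radii c d) auto
  from definable_pred_ex_block[OF this]
  have ex: "definable_pred S (Suc n) (\<lambda>v. \<exists>w. ?Q (?mix v w))" .
  have mix: "clear_radii n E e (?mix v w) y = clear_radii n E e v y" for e v w y
    by (simp add: clear_radii_def near_def)
  have weights: "weight y * r < weight (- y) * s \<longleftrightarrow>
      0 \<le> y \<and> (1 + y) * r < s \<or> y < 0 \<and> r < (1 + - y) * s" for y r s :: 'a
    by (cases "0 \<le> y") (simp_all add: weight_def max_def)
  have "(\<exists>w. ?Q (?mix v w)) \<longleftrightarrow> below (clearance n E c v) (clearance n E d v) (v n)" for v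
    unfolding below_iff_radii[OF c(1) d(1)]
  proof
    assume "\<exists>w. ?Q (?mix v w)"
    then obtain w where w: "?Q (?mix v w)" ..
    then have "w (n + 3) = - v n" by (simp add: eq_neg_iff_add_eq_0)
    then show "\<exists>r s. r \<notin> clear_radii n E c v (v n) \<and> s \<in> clear_radii n E d v (- v n) \<and>
        weight (v n) * r < weight (- v n) * s"
      using w unfolding mix weights by (intro exI[of _ "w (n + 1)"] exI[of _ "w (n + 2)"]) simp
  next
    assume "\<exists>r s. r \<notin> clear_radii n E c v (v n) \<and> s \<in> clear_radii n E d v (- v n) \<and>
        weight (v n) * r < weight (- v n) * s"
    then obtain r s where rs: "r \<notin> clear_radii n E c v (v n)"
      "s \<in> clear_radii n E d v (- v n)" "weight (v n) * r < weight (- v n) * s" by blast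
    then show "\<exists>w. ?Q (?mix v w)"
      unfolding mix weights
      by (intro exI[of _ "(\<lambda>_. 0)(n + 1 := r, n + 2 := s, n + 3 := - v n)"]) simp
  qed
  then show ?thesis using ex by simp
qed

lemma isLub_clear_radii:
  assumes "definably_complete S"
    and "definable_pred S (n + 2) (\<lambda>v. v (n + 1) \<in> clear_radii n E c v (v n))"
  shows "\<exists>d. isLub UNIV (clear_radii n E c x y) d"
proof -
  define v where "v = (\<lambda>i. if i < n then x i else y)"
  have "clear_radii n E c (v(n + 1 := a)) ((v(n + 1 := a)) n) = clear_radii n E c x y" for a
    by (simp add: clear_radii_def near_def v_def)
  then have "definable1 S (clear_radii n E c x y)"
    using definable_pred_imp_definable1[OF assms(2), of "n + 1" v] by simp
  then show ?thesis
    by (rule definably_complete_isLub[OF assms(1), of _ 0 1]) (auto simp: clear_radii_def)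
qed

section \<open>Cuts given by definable semicontinuous maps\<close>

text \<open>
  Access to the finite values of \<open>f\<close> through its definable graph; the infinite values are
  covered separately by the lemmas that follow.
\<close>

lemma definable_pred_ext_map_value:
  assumes "definable_ext_map S n E f"
    and rel: "definable_pred S (n + 2) (\<lambda>v. R (v (n + 1)) (v n))"
  shows "definable_pred S (Suc n)
    (\<lambda>v. \<exists>s. restrict v {..<n} \<in> E \<and> f (restrict v {..<n}) = Fin s \<and> R s (v n))"
proof -
  have "definable_map S n {x \<in> E. f x \<in> range Fin} (\<lambda>x. inv Fin (f x))"
    using assms(1) by (simp add: definable_ext_map_def)
  then have graph: "definable_pred S (Suc n) (\<lambda>v. restrict v {..<n} \<in> {x \<in> E. f x \<in> range Fin} \<and>
      inv Fin (f (restrict v {..<n})) = v n)"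
    by (simp only: definable_map_iff_definable_pred)
  let ?\<rho> = "\<lambda>i. if i < n then i else n + 1"
  have "restrict (\<lambda>i. v (?\<rho> i)) {..<n} = restrict v {..<n}" for v :: "nat \<Rightarrow> 'a"
    by auto
  then have "definable_pred S (n + 2) (\<lambda>v. restrict v {..<n} \<in> {x \<in> E. f x \<in> range Fin} \<and>
      inv Fin (f (restrict v {..<n})) = v (n + 1))"
    using definable_pred_rename[OF graph, of ?\<rho> "n + 2"]
    by (simp add: inj_on_def)
  from definable_pred_conj[OF this rel]
  have "definable_pred S (Suc (Suc n)) (\<lambda>v. (restrict v {..<n} \<in> {x \<in> E. f x \<in> range Fin} \<and>
      inv Fin (f (restrict v {..<n})) = v (n + 1)) \<and> R (v (n + 1)) (v n))"
    by simp
  from definable_pred_ex[OF this]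
  have "definable_pred S (Suc n) (\<lambda>v. \<exists>s. (restrict v {..<n} \<in> {x \<in> E. f x \<in> range Fin} \<and>
      inv Fin (f (restrict v {..<n})) = s) \<and> R s (v n))"
    by simp
  moreover have "inj (Fin :: 'a \<Rightarrow> 'a extended)"
    by (simp add: inj_def)
  then have "(e \<in> range Fin \<and> inv Fin e = s) \<longleftrightarrow> e = Fin s" for e :: "'a extended" and s
    by (auto simp: inv_f_f)
  then have finite_value: "((x \<in> {x \<in> E. f x \<in> range Fin} \<and> inv Fin (f x) = s) \<and> Q) \<longleftrightarrow>
      (x \<in> E \<and> f x = Fin s \<and> Q)" for x s Q
    by blast
  ultimately show ?thesis by (simp only: finite_value)
qed

lemma definable_pred_ext_map_le:
  assumes "definable_ext_map S n E f"
  shows "definable_pred S (Suc n)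
    (\<lambda>v. restrict v {..<n} \<in> E \<and> f (restrict v {..<n}) \<le> Fin (v n))"
proof -
  have "definable S n {x \<in> E. f x = Minf}"
    using assms by (simp add: definable_ext_map_def)
  from definable_pred_weaken[OF definable_imp_definable_pred[OF this]]
  have "definable_pred S (Suc n) (\<lambda>v. restrict v {..<n} \<in> {x \<in> E. f x = Minf})"
    by simp
  moreover have "definable_pred S (Suc n)
      (\<lambda>v. \<exists>s. restrict v {..<n} \<in> E \<and> f (restrict v {..<n}) = Fin s \<and> s \<le> v n)"
    by (intro definable_pred_ext_map_value assms definable_pred_intros) auto
  ultimately have "definable_pred S (Suc n) (\<lambda>v. restrict v {..<n} \<in> {x \<in> E. f x = Minf} \<or>
      (\<exists>s. restrict v {..<n} \<in> E \<and> f (restrict v {..<n}) = Fin s \<and> s \<le> v n))"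
    by (rule definable_pred_disj)
  moreover have "e \<le> Fin t \<longleftrightarrow> e = Minf \<or> (\<exists>s. e = Fin s \<and> s \<le> t)" for e and t :: 'a
    by (cases e) auto
  then have "(x \<in> {x \<in> E. f x = Minf} \<or> (\<exists>s. x \<in> E \<and> f x = Fin s \<and> s \<le> t)) \<longleftrightarrow>
      x \<in> E \<and> f x \<le> Fin t" for x t
    by blast
  ultimately show ?thesis by simp
qed

lemma definable_pred_ext_map_ge_uminus:
  assumes "definable_ext_map S n E g"
  shows "definable_pred S (Suc n)
    (\<lambda>v. restrict v {..<n} \<in> E \<and> Fin (- v n) \<le> g (restrict v {..<n}))"
proof -
  have "definable S n {x \<in> E. g x = Pinf}"
    using assms by (simp add: definable_ext_map_def)
  from definable_pred_weaken[OF definable_imp_definable_pred[OF this]]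
  have "definable_pred S (Suc n) (\<lambda>v. restrict v {..<n} \<in> {x \<in> E. g x = Pinf})"
    by simp
  moreover have "definable_pred S (Suc n)
      (\<lambda>v. \<exists>s. restrict v {..<n} \<in> E \<and> g (restrict v {..<n}) = Fin s \<and> 0 \<le> s + v n)"
    by (intro definable_pred_ext_map_value[where R = "\<lambda>s t. 0 \<le> s + t"] assms definable_pred_intros)
      auto
  ultimately have "definable_pred S (Suc n) (\<lambda>v. restrict v {..<n} \<in> {x \<in> E. g x = Pinf} \<or>
      (\<exists>s. restrict v {..<n} \<in> E \<and> g (restrict v {..<n}) = Fin s \<and> 0 \<le> s + v n))"
    by (rule definable_pred_disj)
  moreover have "Fin (- t) \<le> e \<longleftrightarrow> e = Pinf \<or> (\<exists>s. e = Fin s \<and> 0 \<le> s + t)" for e and t :: 'a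
    by (cases e) (auto simp: minus_le_iff neg_le_iff_le le_minus_iff algebra_simps dest: add_le_imp_le_right)
  then have "(x \<in> {x \<in> E. g x = Pinf} \<or> (\<exists>s. x \<in> E \<and> g x = Fin s \<and> 0 \<le> s + t)) \<longleftrightarrow>
      x \<in> E \<and> Fin (- t) \<le> g x" for x t
    by blast
  ultimately show ?thesis by simp
qed

text \<open>
  Semicontinuity makes a strict inequality \<open>D\<close> open, whereas a cut is given by the weak
  inequality \<open>C\<close>. The two are interlaced, so a slightly larger height passes from the one
  to the other.
\<close>

lemma semicontinuous_cut_if_definable:
  fixes S :: "('a::{linordered_field, linorder_topology}, 'f, 'r) expansion"
  assumes S: "definably_complete S"
    and E: "definable S n E" "E \<subseteq> power_space n"
    and c: "definable_pred S (Suc n) (\<lambda>v. restrict v {..<n} \<in> E \<and> C (restrict v {..<n}) (v n))"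
    and up: "\<forall>x t t'. C x t \<longrightarrow> t \<le> t' \<longrightarrow> C x t'"
    and op: "\<And>t. openin (subspace_top n E) {x \<in> E. D x t}"
    and interlaced: "\<forall>x t t'. C x t \<longrightarrow> t < t' \<longrightarrow> D x t'" "\<forall>x t. D x t \<longrightarrow> C x t"
  shows "semicontinuous_cut n E (\<lambda>x t. x \<in> E \<and> C x t)"
    and "definable_pred S (n + 2)
      (\<lambda>v. v (n + 1) \<in> clear_radii n E (\<lambda>x t. x \<in> E \<and> C x t) v (v n))"
proof -
  show radii: "definable_pred S (n + 2)
      (\<lambda>v. v (n + 1) \<in> clear_radii n E (\<lambda>x t. x \<in> E \<and> C x t) v (v n))"
    using definable_imp_definable_pred[OF E(1)] E(2) c by (rule definable_pred_clear_radii)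
  show "semicontinuous_cut n E (\<lambda>x t. x \<in> E \<and> C x t)"
  proof
    fix x t t' assume "x \<in> E" "x \<in> E \<and> C x t" "t < t'"
    then have x: "x \<in> {x \<in> E. D x t'}" using interlaced(1) by blast
    have "\<forall>x\<in>{x \<in> E. D x t'}. \<exists>\<delta>>0. \<forall>z\<in>E. near n \<delta> x z \<longrightarrow> z \<in> {x \<in> E. D x t'}"
      using op[of t'] unfolding openin_subspace_top_iff[OF E(2)] by (rule conjunct2)
    from bspec[OF this x]
    obtain \<delta> where "0 < \<delta>" "\<forall>z\<in>E. near n \<delta> x z \<longrightarrow> z \<in> {x \<in> E. D x t'}"
      by (elim exE conjE)
    then show "\<exists>\<delta>>0. \<forall>z\<in>E. near n \<delta> x z \<longrightarrow> z \<in> E \<and> C z t'"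
      using interlaced(2) by (intro exI[of _ \<delta>]) simp
  next
    fix x y
    show "\<exists>d. isLub UNIV (clear_radii n E (\<lambda>x t. x \<in> E \<and> C x t) x y) d"
      using S radii by (rule isLub_clear_radii)
  qed (use up in auto)
qed

section \<open>Insertion\<close>

text \<open>
  The balance points over the points of \<open>E\<close> form the inserted map. It is continuous because
  heights below and above balance are stable under small moves of \<open>x\<close>, and definable because
  the balance point is the only height that separates those below balance from the others.
\<close>

lemma definably_complete_insertion:
  fixes S :: "('a::{linordered_field, linorder_topology}, 'f, 'r) expansion"
    and f g :: "(nat \<Rightarrow> 'a) \<Rightarrow> 'a extended"
  assumes S: "definably_complete S"
    and dE: "definable S n E"
    and df: "definable_ext_map S n E f"
    and dg: "definable_ext_map S n E g"
    and ne: "\<And>x. x \<in> E \<Longrightarrow> \<exists>w. f x \<le> Fin w \<and> Fin w \<le> g x"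
    and usc: "upper_semicontinuous (subspace_top n E) f"
    and lsc: "lower_semicontinuous (subspace_top n E) g"
  shows "\<exists>h. definable_map S n E h \<and> continuous_map (subspace_top n E) euclidean h \<and>
    (\<forall>x\<in>E. f x \<le> Fin (h x) \<and> Fin (h x) \<le> g x \<and>
      (f x < g x \<longrightarrow> f x < Fin (h x) \<and> Fin (h x) < g x))"
proof -
  have E: "E \<subseteq> power_space n"
    using dE by (auto simp: definable_def)
  \<comment> \<open>Membership in E is part of the cuts since f and g are only definable on E.\<close>
  define c where "c = (\<lambda>x t. x \<in> E \<and> f x \<le> Fin t)"
  define d where "d = (\<lambda>x t. x \<in> E \<and> Fin (- t) \<le> g x)"
  have f_open: "openin (subspace_top n E) {x \<in> E. f x < Fin t}" for t
    using usc by (simp add: upper_semicontinuous_def topspace_subspace_top[OF E])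
  have "f x \<le> Fin t'" if "f x \<le> Fin t" "t \<le> t'" for x t t'
    using that by (cases "f x") auto
  then have f_up: "\<forall>x t t'. f x \<le> Fin t \<longrightarrow> t \<le> t' \<longrightarrow> f x \<le> Fin t'"
    by simp
  have "f x < Fin t'" if "f x \<le> Fin t" "t < t'" for x t t'
    using that by (cases "f x") auto
  then have f_strict: "\<forall>x t t'. f x \<le> Fin t \<longrightarrow> t < t' \<longrightarrow> f x < Fin t'"
    by simp
  have f_weak: "\<forall>x t. f x < Fin t \<longrightarrow> f x \<le> Fin t"
    by (simp add: less_imp_le)
  note c = semicontinuous_cut_if_definable
    [where C = "\<lambda>x t. f x \<le> Fin t" and D = "\<lambda>x t. f x < Fin t",
     OF S dE E definable_pred_ext_map_le[OF df] f_up f_open f_strict f_weak, folded c_def]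
  have g_open: "openin (subspace_top n E) {x \<in> E. Fin (- t) < g x}" for t
    using lsc by (simp add: lower_semicontinuous_def topspace_subspace_top[OF E])
  have "Fin (- t') \<le> g x" if "Fin (- t) \<le> g x" "t \<le> t'" for x t t'
    using that by (cases "g x") auto
  then have g_up: "\<forall>x t t'. Fin (- t) \<le> g x \<longrightarrow> t \<le> t' \<longrightarrow> Fin (- t') \<le> g x"
    by simp
  have "Fin (- t') < g x" if "Fin (- t) \<le> g x" "t < t'" for x t t'
    using that by (cases "g x") auto
  then have g_strict: "\<forall>x t t'. Fin (- t) \<le> g x \<longrightarrow> t < t' \<longrightarrow> Fin (- t') < g x"
    by simp
  have g_weak: "\<forall>x t. Fin (- t) < g x \<longrightarrow> Fin (- t) \<le> g x"
    by (simp add: less_imp_le)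
  note d = semicontinuous_cut_if_definable
    [where C = "\<lambda>x t. Fin (- t) \<le> g x" and D = "\<lambda>x t. Fin (- t) < g x",
     OF S dE E definable_pred_ext_map_ge_uminus[OF dg] g_up g_open g_strict g_weak, folded d_def]
  interpret c: semicontinuous_cut n E c by (rule c)
  interpret d: semicontinuous_cut n E d by (rule d)
  have c_pos: "0 < c.clr x y \<longleftrightarrow> f x < Fin y" if "x \<in> E" for x y
  proof -
    have "(\<exists>t<y. f x \<le> Fin t) \<longleftrightarrow> f x < Fin y"
    proof (cases "f x")
      case (Fin q)
      then show ?thesis by auto
    next
      case Minf
      then show ?thesis using lt_ex[of y] by simp
    qed simp
    then show ?thesis using that unfolding c.clr_pos_iff[OF that] by (simp add: c_def)
  qed
  have d_pos: "0 < d.clr x y \<longleftrightarrow> Fin (- y) < g x" if "x \<in> E" for x y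
  proof -
    have "(\<exists>t<y. Fin (- t) \<le> g x) \<longleftrightarrow> Fin (- y) < g x"
    proof (cases "g x")
      case (Fin q)
      have "\<exists>t<y. - t \<le> q" if "- y < q"
        using that by (intro exI[of _ "- q"]) (simp add: minus_less_iff)
      then show ?thesis using Fin by auto
    next
      case Pinf
      then show ?thesis using lt_ex[of y] by simp
    qed simp
    then show ?thesis using that unfolding d.clr_pos_iff[OF that] by (simp add: d_def)
  qed
  have pair: "distance_pair (c.clr x) (d.clr x)" if x: "x \<in> E" for x
  proof
    fix y z :: 'a assume "y < z"
    obtain w where "f x \<le> Fin w" "Fin w \<le> g x" using ne[OF x] by blast
    then have "f x < Fin z \<or> Fin y < g x"
      using \<open>y < z\<close> by (cases "f x"; cases "g x") auto
    then show "0 < c.clr x z \<or> 0 < d.clr x (- y)"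
      by (simp add: c_pos[OF x] d_pos[OF x])
  qed (simp_all add: c.clr_mono d.clr_mono c.clr_nonneg d.clr_nonneg c.clr_le_1 d.clr_le_1
      c.clr_shift d.clr_shift)
  have dbelow: "definable_pred S (Suc n) (\<lambda>v. below (c.clr v) (d.clr v) (v n))"
    using c d by (rule definable_pred_below)
  define P where "P = (\<lambda>x h. (\<forall>y<h. below (c.clr x) (d.clr x) y) \<and>
      (\<forall>y>h. below (d.clr x) (c.clr x) (- y)) \<and>
      f x \<le> Fin h \<and> Fin h \<le> g x \<and> (f x < g x \<longrightarrow> f x < Fin h \<and> Fin h < g x))"
  have "\<forall>x\<in>E. \<exists>h. P x h"
  proof
    fix x assume x: "x \<in> E"
    interpret distance_pair "c.clr x" "d.clr x" using x by (rule pair)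
    obtain w where w: "f x \<le> Fin w" "Fin w \<le> g x" using ne[OF x] by blast
    have cong: "clearance n E e (x(n := y)) = clearance n E e x" for e y
      by (rule clearance_cong) simp
    have "definable1 S {y. below (c.clr x) (d.clr x) y}"
      using definable_pred_imp_definable1[OF dbelow, of n x] by (simp add: cong)
    then have lub: "\<exists>h. isLub UNIV {y. below (c.clr x) (d.clr x) y} h"
      if yz: "below (c.clr x) (d.clr x) y" "\<not> below (c.clr x) (d.clr x) z" for y z
    proof (rule definably_complete_isLub[OF S])
      show "y \<in> {y. below (c.clr x) (d.clr x) y}" using yz(1) by simp
      show "t \<le> z" if "t \<in> {y. below (c.clr x) (d.clr x) y}" for t
        using that yz(2) below_downward[of t z] by (cases "t \<le> z") auto
    qed
    show "\<exists>h. P x h"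
      unfolding P_def by (rule balance_point[OF pair[OF x] c_pos[OF x] d_pos[OF x] w lub])
  qed
  from bchoice[OF this] obtain h where h: "\<forall>x\<in>E. P x (h x)"
    by (elim exE)
  have
    low: "\<And>x y. x \<in> E \<Longrightarrow> y < h x \<Longrightarrow> below (c.clr x) (d.clr x) y" and
    high: "\<And>x y. x \<in> E \<Longrightarrow> h x < y \<Longrightarrow> below (d.clr x) (c.clr x) (- y)" and
    between: "\<And>x. x \<in> E \<Longrightarrow> f x \<le> Fin (h x) \<and> Fin (h x) \<le> g x \<and>
      (f x < g x \<longrightarrow> f x < Fin (h x) \<and> Fin (h x) < g x)"
    using h unfolding P_def by simp_all
  have not_both: "\<not> below (c.clr x) (d.clr x) y" if "below (d.clr x) (c.clr x) (- y)" for x y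
    using that by (auto simp: below_def)
  have continuous: "continuous_map (subspace_top n E) euclidean h"
  proof (rule continuous_map_if_locally_bounded[OF E])
    fix x y assume x: "x \<in> E" "y < h x"
    obtain m where m: "y < m" "m < h x" using dense[OF x(2)] by blast
    obtain \<delta> where "0 < \<delta>" "\<forall>z. near n \<delta> x z \<longrightarrow> below (c.clr z) (d.clr z) m"
      using below_nearby[OF c(1) d(1) low[OF x(1) m(2)]] by blast
    moreover have "y < h z" if "z \<in> E" "below (c.clr z) (d.clr z) m" for z
      using high[OF that(1), of m] not_both[of z m] that(2) m(1) by (cases "m \<le> h z") auto
    ultimately show "\<exists>\<delta>>0. \<forall>z\<in>E. near n \<delta> x z \<longrightarrow> y < h z"
      by (intro exI[of _ \<delta>]) simp
  next
    fix x y assume x: "x \<in> E" "h x < y"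
    obtain m where m: "h x < m" "m < y" using dense[OF x(2)] by blast
    obtain \<delta> where "0 < \<delta>" "\<forall>z. near n \<delta> x z \<longrightarrow> below (d.clr z) (c.clr z) (- m)"
      using below_nearby[OF d(1) c(1) high[OF x(1) m(1)]] by blast
    moreover have "h z < y" if "z \<in> E" "below (d.clr z) (c.clr z) (- m)" for z
      using low[OF that(1), of m] not_both[of z m] that(2) m(2) by (cases "h z \<le> m") auto
    ultimately show "\<exists>\<delta>>0. \<forall>z\<in>E. near n \<delta> x z \<longrightarrow> h z < y"
      by (intro exI[of _ \<delta>]) simp
  qed
  have graph: "h x = z \<longleftrightarrow> (\<forall>y. (y < z \<longrightarrow> below (c.clr x) (d.clr x) y) \<and>
      (z < y \<longrightarrow> \<not> below (c.clr x) (d.clr x) y))" if x: "x \<in> E" for x z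
  proof
    assume "h x = z"
    then show "\<forall>y. (y < z \<longrightarrow> below (c.clr x) (d.clr x) y) \<and>
        (z < y \<longrightarrow> \<not> below (c.clr x) (d.clr x) y)"
      using low[OF x] high[OF x] not_both by blast
  next
    assume z: "\<forall>y. (y < z \<longrightarrow> below (c.clr x) (d.clr x) y) \<and>
        (z < y \<longrightarrow> \<not> below (c.clr x) (d.clr x) y)"
    show "h x = z"
    proof (rule linorder_cases)
      assume "h x < z"
      then obtain m where "h x < m" "m < z" using dense by blast
      then show ?thesis using z high[OF x] not_both by blast
    next
      assume "z < h x"
      then obtain m where "z < m" "m < h x" using dense by blast
      then show ?thesis using z low[OF x] by blast
    qed
  qed
  let ?\<rho> = "\<lambda>i. if i < n then i else n + 1"
  have "clearance n E e (\<lambda>i. v (?\<rho> i)) = clearance n E e v" for e v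
    by (rule clearance_cong) simp
  then have below': "definable_pred S (Suc (Suc n)) (\<lambda>v. below (c.clr v) (d.clr v) (v (n + 1)))"
    using definable_pred_rename[OF dbelow, of ?\<rho> "Suc (Suc n)"] by (simp add: inj_on_def)
  have "definable_pred S (Suc (Suc n)) (\<lambda>v. (v (n + 1) < v n \<longrightarrow> below (c.clr v) (d.clr v) (v (n + 1))) \<and>
      (v n < v (n + 1) \<longrightarrow> \<not> below (c.clr v) (d.clr v) (v (n + 1))))"
    by (intro definable_pred_intros below') auto
  from definable_pred_all[OF this]
  have "definable_pred S (Suc n) (\<lambda>v. \<forall>y. (y < v n \<longrightarrow> below (c.clr (v(Suc n := y))) (d.clr (v(Suc n := y))) y) \<and>
      (v n < y \<longrightarrow> \<not> below (c.clr (v(Suc n := y))) (d.clr (v(Suc n := y))) y))"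
    by simp
  moreover have "clearance n E e (v(Suc n := y)) = clearance n E e (restrict v {..<n})" for e v y
    by (rule clearance_cong) simp
  ultimately have "definable_pred S (Suc n) (\<lambda>v. \<forall>y.
      (y < v n \<longrightarrow> below (c.clr (restrict v {..<n})) (d.clr (restrict v {..<n})) y) \<and>
      (v n < y \<longrightarrow> \<not> below (c.clr (restrict v {..<n})) (d.clr (restrict v {..<n})) y))"
    by simp
  with definable_pred_weaken[OF definable_imp_definable_pred[OF dE] le_SucI[OF order_refl]]
  have "definable_pred S (Suc n) (\<lambda>v. restrict v {..<n} \<in> E \<and> (\<forall>y.
      (y < v n \<longrightarrow> below (c.clr (restrict v {..<n})) (d.clr (restrict v {..<n})) y) \<and>
      (v n < y \<longrightarrow> \<not> below (c.clr (restrict v {..<n})) (d.clr (restrict v {..<n})) y)))"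
    by (rule definable_pred_conj)
  then have "definable_pred S (Suc n) (\<lambda>v. restrict v {..<n} \<in> E \<and> h (restrict v {..<n}) = v n)"
    by (simp add: graph cong: conj_cong)
  then have "definable_map S n E h"
    by (simp only: definable_map_iff_definable_pred)
  then show ?thesis using continuous between by blast
qed

theorem theorem4p5:
  fixes S :: "('a::{linordered_field, linorder_topology}, 'f, 'r) expansion"
    and n :: nat
    and E :: "(nat \<Rightarrow> 'a) set"
    and f g :: "(nat \<Rightarrow> 'a) \<Rightarrow> 'a extended"
  assumes "d_minimal S"
    and "definable S n E"
    and "definable_ext_map S n E f"
    and "definable_ext_map S n E g"
    and "\<And>x. x \<in> E \<Longrightarrow> {y :: 'a. f x \<le> Fin y \<and> Fin y \<le> g x} \<noteq> {}"
    and "upper_semicontinuous (subspace_top n E) f"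
    and "lower_semicontinuous (subspace_top n E) g"
  shows "\<exists>h :: (nat \<Rightarrow> 'a) \<Rightarrow> 'a.
           definable_map S n E h \<and>
           continuous_map (subspace_top n E) euclidean h \<and>
           (\<forall>x\<in>E. f x \<le> Fin (h x) \<and> Fin (h x) \<le> g x) \<and>
           (\<forall>x\<in>E. f x < g x \<longrightarrow> f x < Fin (h x) \<and> Fin (h x) < g x)"
proof -
  have "definably_complete S"
    using assms(1) by (simp add: d_minimal_def)
  moreover have "\<exists>w. f x \<le> Fin w \<and> Fin w \<le> g x" if "x \<in> E" for x
    using assms(5)[OF that] by blast
  ultimately obtain h where "definable_map S n E h" "continuous_map (subspace_top n E) euclidean h"
    "\<forall>x\<in>E. f x \<le> Fin (h x) \<and> Fin (h x) \<le> g x \<and>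
      (f x < g x \<longrightarrow> f x < Fin (h x) \<and> Fin (h x) < g x)"
    using definably_complete_insertion[OF _ assms(2-4) _ assms(6,7)] by blast
  then show ?thesis by (intro exI[of _ h]) simp
qed

end
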